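(* Let $G=(V,E)$ be a finite connected graph that is vertex-transitive with respect to a group $\Psi\le\mathrm{Aut}(G)$ (that is, $\Psi$ acts transitively on $V$), and let $\lambda>0$ be a Laplacian eigenvalue of $G$. Then $\ell_\Psi(\mathcal{E}_\lambda)=\{\ell_\Psi(\varphi):\varphi\in\mathcal{E}_\lambda\}$ is a convex cone. In particular, $G$ is lower conformally rigid if and only if there exists a single $\varphi\in\mathcal{E}_{\lambda_2}$ with $\ell_\Psi(\varphi)=\mathcal{O}$, and $G$ is upper conformally rigid if and only if there exists a single $\varphi\in\mathcal{E}_{\lambda_n}$ with $\ell_\Psi(\varphi)=\mathcal{O}$, where $\mathcal{O}=(|\mathcal{O}_1|,\dots,|\mathcal{O}_s|)$ is the vector of sizes of the edge orbits of $\Psi$.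
   Context: $G=(V,E)$ is a finite, connected, simple undirected graph with $n=|V|\ge 2$ vertices. For edge weights $w:E\to\mathbb{R}$, $w\ge 0$, the weighted Laplacian $L(w)$ is the symmetric matrix with quadratic form $\langle\varphi,L(w)\varphi\rangle=\sum_{uv\in E}w_{uv}(\varphi(u)-\varphi(v))^2$ for $\varphi\in\mathbb{R}^V$, and its eigenvalues are $0=\lambda_1(w)\le\lambda_2(w)\le\cdots\le\lambda_n(w)$. Write $\mathbf{1}$ for the all-ones vector, $L=L(\mathbf{1})$, $\lambda_k=\lambda_k(\mathbf{1})$, and $\mathcal{E}_\lambda=\{\varphi\in\mathbb{R}^V: L\varphi=\lambda\varphi\}$. $G$ is lower conformally rigid if $\lambda_2(w)\le\lambda_2$ for all $w\ge 0$ with $\sum_{uv\in E}w_{uv}=|E|$; $G$ is upper conformally rigid if $\lambda_n(w)\ge\lambda_n$ for all $w\ge 0$ with $\sum_{uv\in E}w_{uv}=|E|$. Let $\mathcal{O}_1,\dots,\mathcal{O}_s$ be the orbits of $\Psi$ on the edge set $E$. For $\varphi:V\to\mathbb{R}$, the orbit-energy vector is $\ell_\Psi(\varphi)=\big(\sum_{uv\in\mathcal{O}_i}(\varphi(u)-\varphi(v))^2\big)_{i=1}^s\in\mathbb{R}^s$. *)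

theory Defs
  imports
    "HOL-Analysis.Analysis"
    "HOL-Library.Multiset"
    "HOL-Algebra.Group_Action"
begin

text \<open>The vertex set of a graph is the whole of a finite type \<open>'v\<close>, and the
  edge set is a set of two-element sets of vertices.\<close>

definition simple_graph :: "'v set set \<Rightarrow> bool" where
  "simple_graph E \<longleftrightarrow> (\<forall>e\<in>E. card e = 2)"

definition connected_graph :: "'v set set \<Rightarrow> bool" where
  "connected_graph E \<longleftrightarrow> (\<forall>u v. (u, v) \<in> {(x, y). {x, y} \<in> E}\<^sup>*)"

definition graph_aut_group :: "'v set set \<Rightarrow> ('v \<Rightarrow> 'v) monoid" where
  "graph_aut_group E = (BijGroup UNIV)
     \<lparr>carrier := {g. bij g \<and> (\<forall>u v. {g u, g v} \<in> E \<longleftrightarrow> {u, v} \<in> E)}\<rparr>"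

definition edge_orbits :: "'v set set \<Rightarrow> ('v \<Rightarrow> 'v) set \<Rightarrow> 'v set set set" where
  "edge_orbits E \<Psi> = orbits ((graph_aut_group E)\<lparr>carrier := \<Psi>\<rparr>) E (\<lambda>g e. g ` e)"

text \<open>Edge weights are functions on all sets of vertices; only their values on \<open>E\<close> matter.\<close>

definition laplacian :: "'v::finite set set \<Rightarrow> ('v set \<Rightarrow> real) \<Rightarrow> real^'v^'v" where
  "laplacian E w = (\<chi> u v. if u = v then (\<Sum>e | e \<in> E \<and> u \<in> e. w e)
                           else if {u, v} \<in> E then - w {u, v} else 0)"

definition sq_diff :: "real^'v \<Rightarrow> 'v set \<Rightarrow> real" where
  "sq_diff \<phi> e = (THE d. \<exists>u v. e = {u, v} \<and> d = (\<phi> $ u - \<phi> $ v)\<^sup>2)"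

definition eigenspace :: "real^'v^'v::finite \<Rightarrow> real \<Rightarrow> (real^'v) set" where
  "eigenspace A \<mu> = {x. A *v x = \<mu> *\<^sub>R x}"

definition eigenvalue :: "real^'v^'v::finite \<Rightarrow> real \<Rightarrow> bool" where
  "eigenvalue A \<mu> \<longleftrightarrow> (\<exists>x. x \<noteq> 0 \<and> A *v x = \<mu> *\<^sub>R x)"

text \<open>The eigenvalues of \<open>A\<close> with their (geometric) multiplicities, in increasing order.
  For a symmetric matrix the list has length \<open>CARD('v)\<close>.\<close>

definition eigenvalue_list :: "real^'v^'v::finite \<Rightarrow> real list" where
  "eigenvalue_list A = sorted_list_of_multiset
     (\<Sum>\<mu> | eigenvalue A \<mu>. replicate_mset (dim (eigenspace A \<mu>)) \<mu>)"

text \<open>\<open>lap_eig E w k\<close> is the \<open>k\<close>-th smallest eigenvalue of the weighted Laplacian, counting from \<open>k = 1\<close>.\<close>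

definition lap_eig :: "'v::finite set set \<Rightarrow> ('v set \<Rightarrow> real) \<Rightarrow> nat \<Rightarrow> real" where
  "lap_eig E w k = eigenvalue_list (laplacian E w) ! (k - 1)"

definition admissible_weight :: "'v::finite set set \<Rightarrow> ('v set \<Rightarrow> real) \<Rightarrow> bool" where
  "admissible_weight E w \<longleftrightarrow> (\<forall>e\<in>E. 0 \<le> w e) \<and> (\<Sum>e\<in>E. w e) = real (card E)"

definition lower_conformally_rigid :: "'v::finite set set \<Rightarrow> bool" where
  "lower_conformally_rigid E \<longleftrightarrow>
     (\<forall>w. admissible_weight E w \<longrightarrow> lap_eig E w 2 \<le> lap_eig E (\<lambda>_. 1) 2)"

definition upper_conformally_rigid :: "'v::finite set set \<Rightarrow> bool" where
  "upper_conformally_rigid E \<longleftrightarrow>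
     (\<forall>w. admissible_weight E w \<longrightarrow> lap_eig E w CARD('v) \<ge> lap_eig E (\<lambda>_. 1) CARD('v))"

text \<open>\<open>Orb\<close> is an enumeration of the edge orbits, indexed by a finite type \<open>'s\<close>.\<close>

definition orbit_energy :: "('s \<Rightarrow> 'v set set) \<Rightarrow> real^'v \<Rightarrow> real^'s::finite" where
  "orbit_energy Orb \<phi> = (\<chi> i. \<Sum>e\<in>Orb i. sq_diff \<phi> e)"

definition orbit_sizes :: "('s \<Rightarrow> 'v set set) \<Rightarrow> real^'s::finite" where
  "orbit_sizes Orb = (\<chi> i. real (card (Orb i)))"

lemma sq_diff_doubleton: "sq_diff \<phi> {u, v} = (\<phi> $ u - \<phi> $ v)\<^sup>2"
  unfolding sq_diff_def
  by (rule the_equality) (auto simp: doubleton_eq_iff power2_commute)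

lemma transpose_laplacian: "transpose (laplacian E w) = laplacian E w"
  by (auto simp: transpose_def laplacian_def vec_eq_iff insert_commute)

lemma laplacian_quadratic_form:
  fixes E :: "'v::finite set set"
  assumes "simple_graph E"
  shows "\<phi> \<bullet> (laplacian E w *v \<phi>) = (\<Sum>e\<in>E. w e * sq_diff \<phi> e)"
proof -
  let ?c = "\<lambda>e u v. if u = v then (if u \<in> e then 1 else 0)
                    else if e = {u, v} then - 1 else (0::real)"
  have entry: "laplacian E w $ u $ v = (\<Sum>e\<in>E. w e * ?c e u v)" for u v
  proof (cases "u = v")
    case True
    have "(\<Sum>e | e \<in> E \<and> u \<in> e. w e) = (\<Sum>e\<in>E. if u \<in> e then w e else 0)"
      by (rule sum.mono_neutral_cong_left) auto
    also have "\<dots> = (\<Sum>e\<in>E. w e * ?c e u v)"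
      using True by (intro sum.cong) auto
    finally show ?thesis
      using True by (simp add: laplacian_def)
  next
    case False
    have "(\<Sum>e\<in>E. w e * ?c e u v) = (\<Sum>e\<in>E. if e = {u, v} then - w e else 0)"
      using False by (intro sum.cong) auto
    also have "\<dots> = (if {u, v} \<in> E then - w {u, v} else 0)"
      by simp
    finally show ?thesis
      using False by (simp add: laplacian_def)
  qed
  have edge: "(\<Sum>u\<in>UNIV. \<Sum>v\<in>UNIV. ?c e u v * \<phi> $ u * \<phi> $ v) = sq_diff \<phi> e" if "e \<in> E" for e
  proof -
    have "card e = 2"
      using assms that by (auto simp: simple_graph_def)
    then obtain a b where e: "e = {a, b}" and ab: "a \<noteq> b"
      by (auto simp: card_2_iff)
    have z: "?c e u v = 0" if "u \<notin> {a, b} \<or> v \<notin> {a, b}" for u v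
      using that by (auto simp: e doubleton_eq_iff)
    have "(\<Sum>u\<in>UNIV. \<Sum>v\<in>UNIV. ?c e u v * \<phi> $ u * \<phi> $ v)
        = (\<Sum>u\<in>{a, b}. \<Sum>v\<in>UNIV. ?c e u v * \<phi> $ u * \<phi> $ v)"
      by (rule sum.mono_neutral_right) (auto intro!: sum.neutral simp: z)
    also have "\<dots> = (\<Sum>u\<in>{a, b}. \<Sum>v\<in>{a, b}. ?c e u v * \<phi> $ u * \<phi> $ v)"
      by (intro sum.cong sum.mono_neutral_right) (auto simp: z)
    also have "\<dots> = (\<phi> $ a - \<phi> $ b)\<^sup>2"
      using ab by (auto simp: e doubleton_eq_iff power2_eq_square algebra_simps)
    finally show ?thesis
      by (simp add: e sq_diff_doubleton)
  qed
  have "\<phi> \<bullet> (laplacian E w *v \<phi>)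
      = (\<Sum>u\<in>UNIV. \<Sum>v\<in>UNIV. \<Sum>e\<in>E. w e * (?c e u v * \<phi> $ u * \<phi> $ v))"
    by (simp add: inner_vec_def matrix_vector_mult_def entry sum_distrib_left sum_distrib_right
        mult_ac cong: if_cong)
  also have "\<dots> = (\<Sum>u\<in>UNIV. \<Sum>e\<in>E. \<Sum>v\<in>UNIV. w e * (?c e u v * \<phi> $ u * \<phi> $ v))"
    by (intro sum.cong refl sum.swap)
  also have "\<dots> = (\<Sum>e\<in>E. \<Sum>u\<in>UNIV. \<Sum>v\<in>UNIV. w e * (?c e u v * \<phi> $ u * \<phi> $ v))"
    by (rule sum.swap)
  also have "\<dots> = (\<Sum>e\<in>E. w e * sq_diff \<phi> e)"
    by (intro sum.cong refl) (simp only: sum_distrib_left[symmetric] edge)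
  finally show ?thesis .
qed

end

theory Submission
  imports Defs
begin

text \<open>Write \<open>\<ell>\<close> for the orbit energy map and \<open>q\<^sub>i\<close> for its components, which are quadratic forms invariant
under the group.

Convexity (\<open>orbit_energy_add\<close>) is the heart of the matter. Given \<open>\<phi>\<close> and \<open>\<psi>\<close> in an invariant
subspace \<open>S\<close>, average the rank-one operators \<open>\<phi> \<phi>\<^sup>T\<close> and \<open>\<psi> \<psi>\<^sup>T\<close> over the group. The result
\<open>X\<close> is positive semidefinite, commutes with the group, has range in \<open>S\<close>, and remembers the
energies: the trace of \<open>q\<^sub>i\<close> against \<open>X\<close> is a fixed multiple of \<open>q\<^sub>i(\<phi>) + q\<^sub>i(\<psi>)\<close>. Its positive
square root \<open>h\<close> inherits all these symmetries (\<open>positive_square_root\<close>), and the same trace is the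
sum of the energies \<open>q\<^sub>i\<close> of the columns of \<open>h\<close>. The group permutes the columns transitively, because
it permutes the vertices transitively, so all columns have the same energies. Hence one column of
\<open>h\<close>, rescaled, does the work of \<open>\<phi>\<close> and \<open>\<psi>\<close> together: a single vector replaces a sum of squares.

For the rigidity statements, \<open>\<lambda>\<^sub>2\<close> is the minimum of the Rayleigh quotient on the vectors orthogonal
to the constants and \<open>\<lambda>\<^sub>n\<close> is its maximum on the whole space. An eigenvector \<open>\<phi>\<close> whose orbit energies
are the orbit sizes is a certificate: averaged over its translates, its quadratic form for any
admissible weight agrees with that for the constant weight (\<open>sum_group_quadratic_form\<close>), so its
translates are test vectors showing that no weight improves the eigenvalue.

Conversely, suppose that no such \<open>\<phi>\<close> exists. The orbit energies of the eigenvectors with the right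
norm form a compact set, convex by the first part, which a hyperplane separates from the vector of
orbit sizes (\<open>separating_direction\<close>). The normal vector of the hyperplane is a direction in which
to perturb the weights, constantly on each orbit and with total unchanged, such that the
quadratic form moves strictly the same way at every nonzero vector of the eigenspace. By compactness
(\<open>compact_perturbation_bound\<close>) a small step in this direction improves the eigenvalue, contrary to
rigidity.\<close>

section \<open>Symmetric operators on Euclidean spaces\<close>

text \<open>First-order optimality: moving from \<open>x\<close> along the residual \<open>r = f x - m x\<close> changes
\<open>m |y|\<^sup>2 - \<langle>y, f y\<rangle>\<close> at the rate \<open>-2 |r|\<^sup>2\<close>, and this function cannot drop below its value \<open>0\<close> at \<open>x\<close>.\<close>

lemma attained_bound_imp_eigenvector:
  fixes f :: "'a::euclidean_space \<Rightarrow> 'a"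
  assumes f: "linear f" and sym: "\<And>x y. f x \<bullet> y = x \<bullet> f y"
    and S: "subspace S" "f ` S \<subseteq> S"
    and bound: "\<And>y. y \<in> S \<Longrightarrow> y \<bullet> f y \<le> m * (y \<bullet> y)"
    and x: "x \<in> S" "x \<bullet> f x = m * (x \<bullet> x)"
  shows "f x = m *\<^sub>R x"
proof (rule ccontr)
  assume "f x \<noteq> m *\<^sub>R x"
  define r where "r = f x - m *\<^sub>R x"
  have r: "r \<in> S" "r \<bullet> r > 0"
    using S x \<open>f x \<noteq> _\<close> by (auto simp: r_def intro!: subspace_diff subspace_scale)
  define c where "c = r \<bullet> f r - m * (r \<bullet> r)"
  have key: "2 * t * (r \<bullet> r) + t\<^sup>2 * c \<le> 0" for t :: real
  proof -
    have "(x + t *\<^sub>R r) \<bullet> f (x + t *\<^sub>R r) \<le> m * ((x + t *\<^sub>R r) \<bullet> (x + t *\<^sub>R r))"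
      using S x r by (intro bound) (auto intro!: subspace_add subspace_scale)
    moreover have "x \<bullet> f r = f x \<bullet> r" "r \<bullet> f x = f x \<bullet> r"
      by (simp add: sym) (simp add: inner_commute)
    ultimately have "2 * t * (f x \<bullet> r - m * (x \<bullet> r)) + t\<^sup>2 * c \<le> 0"
      using x(2) by (simp add: c_def linear_add[OF f] linear_scale[OF f] inner_commute[of r x]
          algebra_simps power2_eq_square)
    then show ?thesis
      by (simp add: r_def inner_diff_left)
  qed
  \<comment> \<open>a step small enough for the linear term to dominate the quadratic one\<close>
  define t where "t = (r \<bullet> r) / (\<bar>c\<bar> + 1)"
  have "t > 0" using r by (simp add: t_def add_nonneg_pos)
  have "t * \<bar>c\<bar> \<le> r \<bullet> r"
    using r by (simp add: t_def field_simps)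
  then have "t * (t * \<bar>c\<bar>) \<le> t * (r \<bullet> r)"
    using \<open>t > 0\<close> by simp
  moreover have "t\<^sup>2 * (- c) \<le> t\<^sup>2 * \<bar>c\<bar>"
    by (intro mult_left_mono) auto
  moreover have "t * (r \<bullet> r) > 0" using \<open>t > 0\<close> r by simp
  ultimately show False using key[of t] by (simp add: power2_eq_square)
qed

lemma exists_eigenvector_in_subspace:
  fixes f :: "'a::euclidean_space \<Rightarrow> 'a"
  assumes f: "linear f" and sym: "\<And>x y. f x \<bullet> y = x \<bullet> f y"
    and S: "subspace S" "f ` S \<subseteq> S" "S \<noteq> {0}"
  obtains x m where "x \<in> S" "norm x = 1" "f x = m *\<^sub>R x"
proof -
  let ?K = "S \<inter> sphere 0 1"
  have comp: "compact ?K"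
    using closed_subspace[OF S(1)] by (simp add: closed_Int_compact)
  obtain z where "z \<in> S" "z \<noteq> 0"
    using S subspace_0 by blast
  then have "(1 / norm z) *\<^sub>R z \<in> ?K"
    using S by (auto intro: subspace_scale)
  moreover have "continuous_on ?K (\<lambda>x. x \<bullet> f x)"
    by (intro continuous_intros linear_continuous_on linear_conv_bounded_linear[THEN iffD1] f)
  ultimately obtain x where x: "x \<in> ?K" "\<And>y. y \<in> ?K \<Longrightarrow> y \<bullet> f y \<le> x \<bullet> f x"
    using continuous_attains_sup[OF comp, of "\<lambda>x. x \<bullet> f x"] by blast
  have "f x = (x \<bullet> f x) *\<^sub>R x"
  proof (rule attained_bound_imp_eigenvector[OF f sym S(1,2)])
    fix y assume y: "y \<in> S"
    show "y \<bullet> f y \<le> (x \<bullet> f x) * (y \<bullet> y)"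
    proof (cases "y = 0")
      case False
      then have "(1 / norm y) *\<^sub>R y \<in> ?K"
        using S y by (auto intro: subspace_scale)
      from x(2)[OF this] show ?thesis
        using False by (simp add: linear_scale[OF f] field_simps dot_square_norm power2_eq_square)
    qed (simp add: linear_0[OF f])
  qed (use x in \<open>auto simp: dot_square_norm\<close>)
  with x that show ?thesis by auto
qed

text \<open>The spectral theorem, by induction on the dimension: split off a maximizer of the Rayleigh quotient
and pass to its orthogonal complement within \<open>S\<close>, which is again invariant. Allowing a proper subspace
\<open>S\<close> makes it possible to choose a basis that contains a prescribed eigenvector.\<close>

lemma exists_orthonormal_eigenbasis:
  fixes f :: "'a::euclidean_space \<Rightarrow> 'a"
  assumes f: "linear f" and sym: "\<And>x y. f x \<bullet> y = x \<bullet> f y"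
    and "subspace S" "f ` S \<subseteq> S"
  shows "\<exists>B ev. finite B \<and> pairwise orthogonal B \<and> (\<forall>b\<in>B. norm b = 1 \<and> f b = ev b *\<^sub>R b)
           \<and> span B = S"
  using assms(3,4)
proof (induction "dim S" arbitrary: S rule: less_induct)
  case less
  show ?case
  proof (cases "S = {0}")
    case True
    then show ?thesis by (intro exI[of _ "{}"]) auto
  next
    case False
    obtain x m where x: "x \<in> S" "norm x = 1" "f x = m *\<^sub>R x"
      using exists_eigenvector_in_subspace[OF f sym less.prems False] .
    have xx: "x \<bullet> x = 1" using x by (simp add: dot_square_norm)
    define T where "T = S \<inter> {y. x \<bullet> y = 0}"
    have T: "subspace T" unfolding T_def
      using less.prems by (intro subspace_inter subspace_hyperplane)
    have fT: "f ` T \<subseteq> T"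
      using less.prems x by (auto simp: T_def sym[symmetric])
    have "x \<notin> T" using xx by (simp add: T_def)
    then have "T \<subset> S" using x(1) unfolding T_def by blast
    then have "dim T < dim S"
      using T less.prems by (intro dim_psubset) (simp add: span_eq_iff[THEN iffD2])
    from less.hyps[OF this T fT] obtain B ev where
      B: "finite B" "pairwise orthogonal B" "\<forall>b\<in>B. norm b = 1 \<and> f b = ev b *\<^sub>R b" "span B = T"
      by blast
    have BT: "B \<subseteq> T" using B(4) span_superset by blast
    have "x \<notin> B" using BT \<open>x \<notin> T\<close> by blast
    have "span (insert x B) = S"
    proof
      show "span (insert x B) \<subseteq> S"
        using x BT less.prems by (intro span_minimal) (auto simp: T_def)
      show "S \<subseteq> span (insert x B)"
      proof
        fix y assume y: "y \<in> S"
        have "y - (x \<bullet> y) *\<^sub>R x \<in> T"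
          using y x xx less.prems by (auto simp: T_def inner_diff_right intro!: subspace_diff subspace_scale)
        then show "y \<in> span (insert x B)"
          using B(4) by (auto simp: span_insert)
      qed
    qed
    moreover have "pairwise orthogonal (insert x B)"
      using B(2) BT by (auto simp: pairwise_insert orthogonal_def T_def inner_commute)
    moreover have "\<forall>b\<in>insert x B. norm b = 1 \<and> f b = (ev(x := m)) b *\<^sub>R b"
      using B(3) x \<open>x \<notin> B\<close> by auto
    ultimately show ?thesis using B(1) by (intro exI[of _ "insert x B"] exI[of _ "ev(x := m)"]) auto
  qed
qed

lemma orthonormal_expand:
  fixes B :: "'a::euclidean_space set"
  assumes "finite B" "pairwise orthogonal B" "\<And>b. b \<in> B \<Longrightarrow> norm b = 1" "x \<in> span B"
  shows "x = (\<Sum>b\<in>B. (b \<bullet> x) *\<^sub>R b)"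
  using orthonormal_basis_expand[OF assms(2,3,4,1)] by (simp add: inner_commute)

lemma eigenvalues_eq_if_not_orthogonal:
  fixes f :: "'a::real_inner \<Rightarrow> 'a"
  assumes sym: "\<And>x y. f x \<bullet> y = x \<bullet> f y"
    and "f x = a *\<^sub>R x" "f y = b *\<^sub>R y" "x \<bullet> y \<noteq> 0"
  shows "a = b"
  using sym[of x y] assms(2-) by simp

text \<open>The root \<open>h\<close> multiplies each eigenvector of \<open>f\<close> by the square root of its eigenvalue. An operator that
commutes with \<open>f\<close> maps eigenvectors to eigenvectors with the same eigenvalue and therefore commutes
with \<open>h\<close>; this is how symmetries of \<open>f\<close> pass to \<open>h\<close>.\<close>

lemma positive_square_root:
  fixes f :: "'a::euclidean_space \<Rightarrow> 'a"
  assumes f: "linear f" and sym: "\<And>x y. f x \<bullet> y = x \<bullet> f y"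
    and pos: "\<And>x. x \<bullet> f x \<ge> 0"
  shows "\<exists>h. linear h \<and> (\<forall>x y. h x \<bullet> y = x \<bullet> h y) \<and> (\<forall>x. h (h x) = f x) \<and> range h \<subseteq> range f
    \<and> (\<forall>T. linear T \<longrightarrow> (\<forall>y. T (f y) = f (T y)) \<longrightarrow> (\<forall>x. T (h x) = h (T x)))"
proof -
  obtain B ev where B: "finite B" "pairwise orthogonal B"
      "\<forall>b\<in>B. norm b = 1 \<and> f b = ev b *\<^sub>R b" "span B = UNIV"
    using exists_orthonormal_eigenbasis[OF f sym subspace_UNIV] by auto
  have ev0: "ev b \<ge> 0" if "b \<in> B" for b
    using pos[of b] B that by (auto simp: dot_square_norm)
  define h where "h x = (\<Sum>b\<in>B. (sqrt (ev b) * (b \<bullet> x)) *\<^sub>R b)" for x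
  have ex: "x = (\<Sum>c\<in>B. (c \<bullet> x) *\<^sub>R c)" for x
    using B by (intro orthonormal_expand) auto
  have lin: "linear h"
    by (intro linearI) (simp_all add: h_def inner_add_right algebra_simps sum.distrib scaleR_sum_right)
  have eig: "h x = sqrt m *\<^sub>R x" if "f x = m *\<^sub>R x" for x m
  proof -
    have "h x = (\<Sum>b\<in>B. (sqrt m * (b \<bullet> x)) *\<^sub>R b)"
      unfolding h_def
    proof (intro sum.cong refl)
      fix b assume "b \<in> B"
      then have "ev b = m \<or> b \<bullet> x = 0"
        using eigenvalues_eq_if_not_orthogonal[OF sym _ that] B(3) by blast
      then show "(sqrt (ev b) * (b \<bullet> x)) *\<^sub>R b = (sqrt m * (b \<bullet> x)) *\<^sub>R b"
        by auto
    qed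
    also have "\<dots> = sqrt m *\<^sub>R x"
      by (subst (2) ex) (simp add: scaleR_sum_right)
    finally show ?thesis .
  qed
  have hb: "h b = sqrt (ev b) *\<^sub>R b" if "b \<in> B" for b
    using eig B that by auto
  show ?thesis
  proof (intro exI[of _ h] conjI allI impI)
    show "linear h" by (fact lin)
    show "h x \<bullet> y = x \<bullet> h y" for x y
      by (simp add: h_def inner_sum_left inner_sum_right mult_ac inner_commute)
    show "h (h x) = f x" for x
    proof -
      have "h (h x) = (\<Sum>b\<in>B. (b \<bullet> x) *\<^sub>R (sqrt (ev b) * sqrt (ev b)) *\<^sub>R b)"
        by (subst (2) h_def) (simp add: linear_sum[OF lin] linear_scale[OF lin] hb mult_ac)
      also have "\<dots> = (\<Sum>b\<in>B. (b \<bullet> x) *\<^sub>R f b)"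
        using ev0 B by (intro sum.cong) auto
      also have "\<dots> = f x"
        by (subst (2) ex) (simp add: linear_sum[OF f] linear_scale[OF f])
      finally show ?thesis .
    qed
    show "range h \<subseteq> range f"
    proof
      fix y assume "y \<in> range h"
      then obtain x where y: "y = h x" by auto
      \<comment> \<open>where an eigenvalue is \<open>0\<close>, division by zero contributes \<open>0\<close>, as it should\<close>
      have "y = f (\<Sum>b\<in>B. (b \<bullet> x / sqrt (ev b)) *\<^sub>R b)"
        unfolding y h_def linear_sum[OF f] linear_scale[OF f]
      proof (intro sum.cong refl)
        fix b assume b: "b \<in> B"
        have "(b \<bullet> x / sqrt (ev b)) *\<^sub>R f b = ((b \<bullet> x) * (ev b / sqrt (ev b))) *\<^sub>R b"
          using B b by simp
        then show "(sqrt (ev b) * (b \<bullet> x)) *\<^sub>R b = (b \<bullet> x / sqrt (ev b)) *\<^sub>R f b"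
          using ev0[OF b] by (simp add: real_div_sqrt mult.commute)
      qed
      then show "y \<in> range f" by blast
    qed
    show "T (h x) = h (T x)" if T: "linear T" "\<forall>y. T (f y) = f (T y)" for T x
    proof -
      have "h (T b) = T (h b)" if "b \<in> B" for b
      proof -
        have "f (T b) = ev b *\<^sub>R T b"
          using T B that by (metis linear_scale)
        then show ?thesis using hb[OF that] eig by (simp add: linear_scale[OF T(1)])
      qed
      then have "T (h (\<Sum>c\<in>B. (c \<bullet> x) *\<^sub>R c)) = h (T (\<Sum>c\<in>B. (c \<bullet> x) *\<^sub>R c))"
        by (simp add: linear_sum[OF T(1)] linear_scale[OF T(1)] linear_sum[OF lin] linear_scale[OF lin])
      then show ?thesis using ex[of x] by simp
    qed
  qed
qed

section \<open>The ordered list of eigenvalues of a symmetric matrix\<close>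

lemma symmetric_matrix_inner:
  fixes A :: "real^'v^'v::finite"
  assumes "transpose A = A"
  shows "(A *v x) \<bullet> y = x \<bullet> (A *v y)"
  by (metis dot_lmul_matrix assms vector_transpose_matrix)

lemma subspace_eigenspace: "subspace (eigenspace A \<mu>)"
  by (auto simp: subspace_def eigenspace_def matrix_vector_right_distrib scaleR_add_right
      matrix_vector_mult_scaleR)

lemma exists_unit_eigenvector:
  fixes A :: "real^'v^'v::finite"
  assumes "subspace S" "x \<in> S" "x \<noteq> 0" "A *v x = m *\<^sub>R x"
  shows "\<exists>y\<in>S. norm y = 1 \<and> y \<bullet> (A *v y) = m"
proof (intro bexI conjI)
  show "(1 / norm x) *\<^sub>R x \<in> S" using assms by (intro subspace_scale)
  show "norm ((1 / norm x) *\<^sub>R x) = 1" using assms by simp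
  show "((1 / norm x) *\<^sub>R x) \<bullet> (A *v ((1 / norm x) *\<^sub>R x)) = m"
    using assms by (simp add: matrix_vector_mult_scaleR dot_square_norm power2_eq_square)
qed

lemma eigenbasis_quadratic_form:
  fixes f :: "'a::euclidean_space \<Rightarrow> 'a"
  assumes f: "linear f"
    and B: "finite B" "pairwise orthogonal B" "\<forall>b\<in>B. norm b = 1 \<and> f b = ev b *\<^sub>R b"
    and x: "x \<in> span B"
  shows "x \<bullet> f x = (\<Sum>b\<in>B. ev b * (b \<bullet> x)\<^sup>2)"
proof -
  have ex: "x = (\<Sum>b\<in>B. (b \<bullet> x) *\<^sub>R b)"
    using B x by (intro orthonormal_expand) auto
  have "f x = (\<Sum>b\<in>B. ((b \<bullet> x) * ev b) *\<^sub>R b)"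
    by (subst ex) (use B in \<open>simp add: linear_sum[OF f] linear_scale[OF f]\<close>)
  then show ?thesis
    by (simp add: inner_sum_right power2_eq_square mult_ac inner_commute)
qed

lemma eigenspace_eq_span_eigenbasis:
  fixes A :: "real^'v^'v::finite"
  assumes sym: "transpose A = A"
    and B: "finite B" "pairwise orthogonal B" "\<forall>b\<in>B. norm b = 1 \<and> A *v b = ev b *\<^sub>R b" "span B = UNIV"
  shows "eigenspace A \<mu> = span {b\<in>B. ev b = \<mu>}"
proof
  note s = symmetric_matrix_inner[OF sym]
  show "eigenspace A \<mu> \<subseteq> span {b\<in>B. ev b = \<mu>}"
  proof
    fix x assume "x \<in> eigenspace A \<mu>"
    then have Ax: "A *v x = \<mu> *\<^sub>R x" by (simp add: eigenspace_def)
    have "x = (\<Sum>b\<in>B. (b \<bullet> x) *\<^sub>R b)"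
      using B by (intro orthonormal_expand) auto
    also have "\<dots> = (\<Sum>b | b \<in> B \<and> ev b = \<mu>. (b \<bullet> x) *\<^sub>R b)"
      using B eigenvalues_eq_if_not_orthogonal[of "(*v) A", OF s _ Ax]
      by (intro sum.mono_neutral_right) auto
    also have "\<dots> \<in> span {b\<in>B. ev b = \<mu>}"
      by (intro span_sum span_scale span_base)
    finally show "x \<in> span {b\<in>B. ev b = \<mu>}" .
  qed
  show "span {b\<in>B. ev b = \<mu>} \<subseteq> eigenspace A \<mu>"
    using B subspace_eigenspace by (intro span_minimal) (auto simp: eigenspace_def)
qed

text \<open>The multiplicities in the list of eigenvalues are dimensions of eigenspaces, and each eigenspace is
spanned by the basis vectors that lie in it. So the list can be read off any orthonormal eigenbasis.\<close>

lemma eigenvalue_list_eigenbasis: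
  fixes A :: "real^'v^'v::finite"
  assumes sym: "transpose A = A"
    and B: "finite B" "pairwise orthogonal B" "\<forall>b\<in>B. norm b = 1 \<and> A *v b = ev b *\<^sub>R b" "span B = UNIV"
  shows "eigenvalue_list A = sorted_list_of_multiset (image_mset ev (mset_set B))"
    and "card B = CARD('v)"
proof -
  have ind: "independent B"
    using B by (intro pairwise_orthogonal_independent) auto
  have "card B = dim (span B)"
    using ind indep_card_eq_dim_span by blast
  then show "card B = CARD('v)" using B(4) by simp
  have dim: "dim (eigenspace A \<mu>) = card {b\<in>B. ev b = \<mu>}" for \<mu>
    unfolding eigenspace_eq_span_eigenbasis[OF assms] dim_span
    using ind by (intro dim_eq_card_independent) (rule independent_mono, auto)
  have eig: "eigenvalue A \<mu> \<longleftrightarrow> \<mu> \<in> ev ` B" for \<mu>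
  proof
    assume "eigenvalue A \<mu>"
    then obtain x where x: "x \<noteq> 0" "x \<in> eigenspace A \<mu>"
      by (auto simp: eigenvalue_def eigenspace_def)
    have "{b\<in>B. ev b = \<mu>} \<noteq> {}"
    proof
      assume "{b\<in>B. ev b = \<mu>} = {}"
      then show False using x eigenspace_eq_span_eigenbasis[OF assms, of \<mu>] by (simp only: span_empty) simp
    qed
    then show "\<mu> \<in> ev ` B" by auto
  next
    assume "\<mu> \<in> ev ` B"
    then obtain b where "b \<in> B" "\<mu> = ev b" by auto
    then show "eigenvalue A \<mu>" using B(3) by (auto simp: eigenvalue_def intro!: exI[of _ b])
  qed
  have "(\<Sum>\<mu> | eigenvalue A \<mu>. replicate_mset (dim (eigenspace A \<mu>)) \<mu>) = image_mset ev (mset_set B)"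
  proof (rule multiset_eqI)
    fix \<nu>
    have "count (\<Sum>\<mu> | eigenvalue A \<mu>. replicate_mset (dim (eigenspace A \<mu>)) \<mu>) \<nu>
        = (\<Sum>\<mu> \<in> ev ` B. if \<mu> = \<nu> then card {b\<in>B. ev b = \<mu>} else 0)"
      by (auto simp: count_sum eig dim intro!: sum.cong)
    also have "\<dots> = card {b\<in>B. ev b = \<nu>}"
      using B(1) by (auto simp: card_eq_0_iff)
    also have "\<dots> = count (image_mset ev (mset_set B)) \<nu>"
      using B(1) by (auto simp: count_image_mset' intro!: arg_cong[of _ _ card])
    finally show "count (\<Sum>\<mu> | eigenvalue A \<mu>. replicate_mset (dim (eigenspace A \<mu>)) \<mu>) \<nu>
        = count (image_mset ev (mset_set B)) \<nu>" .
  qed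
  then show "eigenvalue_list A = sorted_list_of_multiset (image_mset ev (mset_set B))"
    by (simp add: eigenvalue_list_def)
qed

lemma largest_eigenvalue:
  fixes A :: "real^'v^'v::finite"
  assumes sym: "transpose A = A"
  defines "m \<equiv> eigenvalue_list A ! (CARD('v) - 1)"
  shows "\<exists>x. x \<noteq> 0 \<and> A *v x = m *\<^sub>R x"
    and "x \<bullet> (A *v x) \<le> m * (x \<bullet> x)"
proof -
  note s = symmetric_matrix_inner[OF sym]
  obtain B ev where B: "finite B" "pairwise orthogonal B"
      "\<forall>b\<in>B. norm b = 1 \<and> A *v b = ev b *\<^sub>R b" "span B = UNIV"
    using exists_orthonormal_eigenbasis[of "(*v) A", OF _ s subspace_UNIV] by auto
  note l = eigenvalue_list_eigenbasis[OF sym B]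
  have len: "length (eigenvalue_list A) = CARD('v)"
    unfolding l(1) l(2)[symmetric]
    by (metis mset_sorted_list_of_multiset size_image_mset size_mset size_mset_set)
  have set: "set (eigenvalue_list A) = ev ` B" and sorted: "sorted (eigenvalue_list A)"
    unfolding l(1) using B(1) by auto
  have "m \<in> set (eigenvalue_list A)"
    unfolding m_def by (intro nth_mem) (simp add: len)
  then obtain b where b: "b \<in> B" "ev b = m" using set by auto
  then show "\<exists>x. x \<noteq> 0 \<and> A *v x = m *\<^sub>R x" using B(3) by (intro exI[of _ b]) auto
  have le: "ev b \<le> m" if "b \<in> B" for b
  proof -
    have "ev b \<in> set (eigenvalue_list A)" using set that by auto
    then obtain i where "i < CARD('v)" "ev b = eigenvalue_list A ! i"
      by (auto simp: in_set_conv_nth len)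
    then show ?thesis unfolding m_def using sorted by (auto intro!: sorted_nth_mono simp: len)
  qed
  have "x \<bullet> (A *v x) = (\<Sum>b\<in>B. ev b * (b \<bullet> x)\<^sup>2)"
    using B by (intro eigenbasis_quadratic_form) auto
  also have "\<dots> \<le> (\<Sum>b\<in>B. m * (b \<bullet> x)\<^sup>2)"
    using le by (intro sum_mono mult_right_mono) auto
  also have "\<dots> = m * (x \<bullet> x)"
    using eigenbasis_quadratic_form[of "\<lambda>x. x" B "\<lambda>_. 1" x] B
    by (simp add: linear_id[unfolded id_def] sum_distrib_left)
  finally show "x \<bullet> (A *v x) \<le> m * (x \<bullet> x)" .
qed

text \<open>The null vector \<open>u\<close>, normalized, extends an eigenbasis of its orthogonal complement to one of the whole
space. Since no eigenvalue is negative, its eigenvalue \<open>0\<close> heads the sorted list, and the next entry is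
the least eigenvalue on the complement. This is right even if \<open>0\<close> is a multiple eigenvalue.\<close>

lemma second_smallest_eigenvalue:
  fixes A :: "real^'v^'v::finite"
  assumes sym: "transpose A = A" and pos: "\<And>x. x \<bullet> (A *v x) \<ge> 0"
    and u: "A *v u = 0" "u \<noteq> 0" and n: "CARD('v) \<ge> 2"
  defines "m \<equiv> eigenvalue_list A ! 1"
  shows "\<exists>x. x \<noteq> 0 \<and> u \<bullet> x = 0 \<and> A *v x = m *\<^sub>R x"
    and "u \<bullet> x = 0 \<Longrightarrow> m * (x \<bullet> x) \<le> x \<bullet> (A *v x)"
proof -
  note s = symmetric_matrix_inner[OF sym]
  have "(*v) A ` {x. u \<bullet> x = 0} \<subseteq> {x. u \<bullet> x = 0}"
    using s[of u] u by auto
  then obtain C ev' where C: "finite C" "pairwise orthogonal C"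
      "\<forall>b\<in>C. norm b = 1 \<and> A *v b = ev' b *\<^sub>R b" "span C = {x. u \<bullet> x = 0}"
    using exists_orthonormal_eigenbasis[of "(*v) A", OF _ s subspace_hyperplane[of u]] by auto
  define e where "e = (1 / norm u) *\<^sub>R u"
  define ev where "ev = ev'(e := 0)"
  have Cu: "u \<bullet> b = 0" if "b \<in> C" for b
    using C(4) span_base[OF that] by auto
  have eu: "u = norm u *\<^sub>R e" "e \<bullet> e = 1" using u by (auto simp: e_def dot_square_norm)
  have eC: "e \<notin> C" using Cu[of e] u eu by (auto simp: e_def)
  have ev: "ev b = ev' b" if "b \<in> C" for b
    using eC that by (auto simp: ev_def)
  have evC: "\<forall>b\<in>C. norm b = 1 \<and> A *v b = ev b *\<^sub>R b" using C(3) ev by auto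
  define B where "B = insert e C"
  have "y \<in> span B" for y
  proof -
    have "u \<bullet> (y - (e \<bullet> y) *\<^sub>R e) = 0"
      using u by (simp add: e_def inner_diff_right dot_square_norm power2_eq_square)
    then show ?thesis using C(4) by (auto simp: B_def span_insert)
  qed
  then have B: "finite B" "pairwise orthogonal B"
      "\<forall>b\<in>B. norm b = 1 \<and> A *v b = ev b *\<^sub>R b" "span B = UNIV"
    using C Cu u evC
    by (auto simp: B_def pairwise_insert orthogonal_def e_def ev_def inner_commute
        matrix_vector_mult_scaleR)
  note l = eigenvalue_list_eigenbasis[OF sym B]
  define L where "L = sorted_list_of_multiset (image_mset ev (mset_set C))"
  have ev0: "ev b \<ge> 0" if "b \<in> C" for b
    using pos[of b] evC that by (auto simp: dot_square_norm)
  have "eigenvalue_list A = insort 0 L"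
    unfolding l(1) B_def L_def using C(1) eC by (simp add: ev_def)
  also have "\<dots> = 0 # L"
    using ev0 C(1) by (intro insort_is_Cons) (auto simp: L_def)
  finally have m: "m = L ! 0" by (simp add: m_def)
  have "card C \<ge> 1" using l(2) n eC C(1) by (simp add: B_def)
  then have C0: "C \<noteq> {}" by auto
  have set: "set L = ev ` C" and sorted: "sorted L"
    using C(1) by (auto simp: L_def)
  have "L \<noteq> []" using set C0 by auto
  then have "m \<in> set L" unfolding m by simp
  then obtain b where b: "b \<in> C" "ev b = m" using set by auto
  then show "\<exists>x. x \<noteq> 0 \<and> u \<bullet> x = 0 \<and> A *v x = m *\<^sub>R x"
    using evC Cu by (intro exI[of _ b]) auto
  have le: "m \<le> ev b" if "b \<in> C" for b
  proof -
    have "ev b \<in> set L" using set that by auto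
    then obtain i where "i < length L" "ev b = L ! i"
      by (auto simp: in_set_conv_nth)
    then show ?thesis unfolding m using sorted by (auto intro!: sorted_nth_mono)
  qed
  assume x: "u \<bullet> x = 0"
  have "m * (x \<bullet> x) = (\<Sum>b\<in>C. m * (b \<bullet> x)\<^sup>2)"
    using eigenbasis_quadratic_form[of "\<lambda>x. x" C "\<lambda>_. 1" x] C x
    by (simp add: linear_id[unfolded id_def] sum_distrib_left)
  also have "\<dots> \<le> (\<Sum>b\<in>C. ev b * (b \<bullet> x)\<^sup>2)"
    using le by (intro sum_mono mult_right_mono) auto
  also have "\<dots> = x \<bullet> (A *v x)"
    using C x evC by (intro eigenbasis_quadratic_form[symmetric]) auto
  finally show "m * (x \<bullet> x) \<le> x \<bullet> (A *v x)" .
qed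

section \<open>The Laplacian of a weighted graph\<close>

lemma sq_diff_nonneg:
  assumes "card e = 2"
  shows "sq_diff x e \<ge> 0"
  using assms by (auto simp: card_2_iff sq_diff_doubleton)

lemma sq_diff_scaleR:
  assumes "card e = 2"
  shows "sq_diff (c *\<^sub>R x) e = c\<^sup>2 * sq_diff x e"
  using assms by (auto simp: card_2_iff sq_diff_doubleton power_mult_distrib simp flip: right_diff_distrib)

lemma continuous_on_sq_diff:
  assumes "card e = 2"
  shows "continuous_on S (\<lambda>x. sq_diff x e)"
  using assms by (auto simp: card_2_iff sq_diff_doubleton intro!: continuous_intros)

lemma laplacian_pos:
  assumes "simple_graph E" "\<And>e. e \<in> E \<Longrightarrow> w e \<ge> 0"
  shows "x \<bullet> (laplacian E w *v x) \<ge> 0"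
  using assms unfolding laplacian_quadratic_form[OF assms(1)]
  by (intro sum_nonneg mult_nonneg_nonneg sq_diff_nonneg) (auto simp: simple_graph_def)

text \<open>The constants annihilate the quadratic form, hence attain its lower bound \<open>0\<close>.\<close>

lemma laplacian_ones:
  assumes "simple_graph E" "\<And>e. e \<in> E \<Longrightarrow> w e \<ge> 0"
  shows "laplacian E w *v 1 = 0"
proof -
  have zero: "sq_diff (1 :: real^'a) e = 0" if "e \<in> E" for e
    using that assms(1) by (auto simp: simple_graph_def card_2_iff sq_diff_doubleton)
  have "- (laplacian E w *v 1) = 0 *\<^sub>R 1"
  proof (rule attained_bound_imp_eigenvector[of "\<lambda>x. - (laplacian E w *v x)" UNIV])
    show "linear (\<lambda>x. - (laplacian E w *v x))"
      by (intro linear_compose_neg matrix_vector_mul_linear)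
    show "- (laplacian E w *v x) \<bullet> y = x \<bullet> - (laplacian E w *v y)" for x y
      by (simp add: symmetric_matrix_inner transpose_laplacian)
    show "y \<bullet> - (laplacian E w *v y) \<le> 0 * (y \<bullet> y)" for y
      using laplacian_pos[OF assms] by simp
    show "1 \<bullet> - (laplacian E w *v 1) = 0 * (1 \<bullet> 1)"
      by (simp add: laplacian_quadratic_form[OF assms(1)] zero)
  qed auto
  then show ?thesis by simp
qed

lemma laplacian_null_constant:
  assumes "simple_graph E" "connected_graph E" and x: "x \<bullet> (laplacian E (\<lambda>_. 1) *v x) = 0"
  shows "x $ u = x $ v"
proof -
  have card: "card e = 2" if "e \<in> E" for e using assms(1) that by (simp add: simple_graph_def)
  have "(\<Sum>e\<in>E. sq_diff x e) = 0"
    using x by (simp add: laplacian_quadratic_form[OF assms(1)])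
  then have zero: "sq_diff x e = 0" if "e \<in> E" for e
    using that by (subst (asm) sum_nonneg_eq_0_iff) (auto intro: sq_diff_nonneg card)
  have "(u, v) \<in> {(x, y). {x, y} \<in> E}\<^sup>*" using assms(2) by (simp add: connected_graph_def)
  then show ?thesis
    by (induction rule: rtrancl_induct) (auto dest!: zero simp: sq_diff_doubleton)
qed

lemma lap_eig_2:
  fixes E :: "'v::finite set set"
  assumes "simple_graph E" "\<And>e. e \<in> E \<Longrightarrow> w e \<ge> 0" "CARD('v) \<ge> 2"
  shows "\<exists>x. x \<noteq> 0 \<and> 1 \<bullet> x = 0 \<and> laplacian E w *v x = lap_eig E w 2 *\<^sub>R x"
    and "1 \<bullet> x = 0 \<Longrightarrow> lap_eig E w 2 * (x \<bullet> x) \<le> x \<bullet> (laplacian E w *v x)"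
  using second_smallest_eigenvalue[OF transpose_laplacian laplacian_pos[OF assms(1,2)]
      laplacian_ones[OF assms(1,2)] _ assms(3)]
  by (simp_all add: lap_eig_def)

lemma lap_eig_max:
  fixes E :: "'v::finite set set"
  shows "\<exists>x. x \<noteq> 0 \<and> laplacian E w *v x = lap_eig E w CARD('v) *\<^sub>R x"
    and "x \<bullet> (laplacian E w *v x) \<le> lap_eig E w CARD('v) * (x \<bullet> x)"
  using largest_eigenvalue[OF transpose_laplacian] by (simp_all add: lap_eig_def)

text \<open>On a connected graph a vector without energy is constant, hence zero if it is orthogonal to the constants.\<close>

lemma lap_eig_2_pos:
  fixes E :: "'v::finite set set"
  assumes E: "simple_graph E" "connected_graph E" and n: "CARD('v) \<ge> 2"
  shows "lap_eig E (\<lambda>_. 1) 2 > 0"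
proof -
  let ?m = "lap_eig E (\<lambda>_. 1) 2" and ?L = "laplacian E (\<lambda>_. 1)"
  obtain x where x: "x \<noteq> 0" "1 \<bullet> x = 0" "?L *v x = ?m *\<^sub>R x"
    using lap_eig_2(1)[of E "\<lambda>_. 1"] E n by auto
  have q: "x \<bullet> (?L *v x) = ?m * (x \<bullet> x)" using x by simp
  have "x \<bullet> (?L *v x) \<noteq> 0"
  proof
    assume "x \<bullet> (?L *v x) = 0"
    then have const: "x $ u = x $ v" for u v using laplacian_null_constant E by blast
    have "x $ v = 0" for v
    proof -
      have "(\<Sum>u\<in>UNIV. x $ u) = (\<Sum>u\<in>(UNIV :: 'v set). x $ v)"
        by (intro sum.cong const refl)
      then show ?thesis using x(2) by (simp add: inner_vec_def)
    qed
    then show False using x(1) by (simp add: vec_eq_iff)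
  qed
  moreover have "x \<bullet> (?L *v x) \<ge> 0" using E by (intro laplacian_pos) auto
  ultimately have "0 < ?m * (x \<bullet> x)" using q by linarith
  then show ?thesis by (rule zero_less_mult_pos2) (use x in simp)
qed

lemma lap_eig_max_pos:
  fixes E :: "'v::finite set set"
  assumes E: "simple_graph E" "connected_graph E" and n: "CARD('v) \<ge> 2"
  shows "lap_eig E (\<lambda>_. 1) CARD('v) > 0"
proof -
  let ?m = "lap_eig E (\<lambda>_. 1) 2" and ?L = "laplacian E (\<lambda>_. 1)"
  obtain x where x: "x \<noteq> 0" "?L *v x = ?m *\<^sub>R x"
    using lap_eig_2(1)[of E "\<lambda>_. 1"] E n by auto
  have "0 < ?m * (x \<bullet> x)" using lap_eig_2_pos[OF assms] x by simp
  also have "\<dots> \<le> lap_eig E (\<lambda>_. 1) CARD('v) * (x \<bullet> x)"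
    using lap_eig_max(2)[of x E "\<lambda>_. 1"] x by simp
  finally show ?thesis by (rule zero_less_mult_pos2) (use x in simp)
qed

lemma connected_graph_nonempty:
  fixes E :: "'v::finite set set"
  assumes "connected_graph E" "CARD('v) \<ge> 2"
  shows "E \<noteq> {}"
proof
  assume "E = {}"
  moreover obtain u v :: 'v where "u \<noteq> v"
    using assms(2) by (metis card_2_iff' ex_card UNIV_I)
  moreover have "(u, v) \<in> {(x, y). {x, y} \<in> E}\<^sup>*"
    using assms(1) by (simp add: connected_graph_def)
  ultimately show False by simp
qed

section \<open>Automorphisms acting on potentials and on edge orbits\<close>

definition translate :: "('v \<Rightarrow> 'v) \<Rightarrow> real^'v \<Rightarrow> real^'v" where
  "translate g x = (\<chi> v. x $ g v)"

lemma translate_nth [simp]: "translate g x $ v = x $ g v"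
  by (simp add: translate_def)

lemma linear_translate: "linear (translate g)"
  by (intro linearI) (simp_all add: vec_eq_iff)

lemma translate_translate: "translate g (translate h x) = translate (h \<circ> g) x"
  by (simp add: vec_eq_iff)

lemma inner_translate:
  assumes "bij g"
  shows "translate g x \<bullet> translate g y = x \<bullet> y"
  unfolding inner_vec_def translate_nth by (rule sum.reindex_bij_betw[OF assms])

lemma translate_axis:
  assumes "inj g"
  shows "translate g (axis (g v) c) = axis v c"
  using assms by (simp add: vec_eq_iff axis_def inj_eq)

lemma sq_diff_translate:
  assumes "card e = 2"
  shows "sq_diff (translate g x) e = sq_diff x (g ` e)"
  using assms by (auto simp: card_2_iff sq_diff_doubleton)

text \<open>The group is given as a plain set of maps, so that its elements act directly on vertices, edges and
vectors, and sums over it can be reindexed by composition. The indices of \<open>Orb\<close> become the coordinates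
of the energy vectors.\<close>

locale graph_symmetries =
  fixes E :: "'v::finite set set" and \<Psi> :: "('v \<Rightarrow> 'v) set" and Orb :: "'s::finite \<Rightarrow> 'v set set"
  assumes simple: "simple_graph E"
    and bij: "g \<in> \<Psi> \<Longrightarrow> bij g"
    and edge_iff: "g \<in> \<Psi> \<Longrightarrow> {g u, g v} \<in> E \<longleftrightarrow> {u, v} \<in> E"
    and id_mem: "id \<in> \<Psi>"
    and comp_mem: "g \<in> \<Psi> \<Longrightarrow> h \<in> \<Psi> \<Longrightarrow> g \<circ> h \<in> \<Psi>"
    and inv_mem: "g \<in> \<Psi> \<Longrightarrow> inv_into UNIV g \<in> \<Psi>"
    and Orb: "bij_betw Orb UNIV (edge_orbits E \<Psi>)"
begin

abbreviation "L \<equiv> laplacian E (\<lambda>_. 1)"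

lemma card_edge: "e \<in> E \<Longrightarrow> card e = 2"
  using simple by (simp add: simple_graph_def)

lemma card_group_pos: "card \<Psi> > 0"
  using id_mem by (auto simp: card_gt_0_iff)

lemma image_edge:
  assumes "g \<in> \<Psi>" "e \<in> E"
  shows "g ` e \<in> E"
proof -
  obtain u v where "e = {u, v}" using card_edge[OF assms(2)] by (auto simp: card_2_iff)
  then show ?thesis using edge_iff[OF assms(1), of u v] assms(2) by simp
qed

text \<open>This is what makes sums over \<open>\<Psi>\<close> invariant under the group.\<close>

lemma bij_betw_comp_right:
  assumes "k \<in> \<Psi>"
  shows "bij_betw (\<lambda>g. g \<circ> k) \<Psi> \<Psi>"
proof -
  have "inj_on (\<lambda>g. g \<circ> k) \<Psi>"
    using bij_is_surj[OF bij[OF assms]] by (intro inj_onI) (simp add: fun_eq_iff, metis surjD)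
  moreover have "(\<lambda>g. g \<circ> k) ` \<Psi> \<subseteq> \<Psi>"
    using comp_mem assms by auto
  ultimately show ?thesis by (simp add: bij_betw_def endo_inj_surj)
qed

lemma edge_orbits_eq: "edge_orbits E \<Psi> = (\<lambda>e. (\<lambda>g. g ` e) ` \<Psi>) ` E"
  by (auto simp: edge_orbits_def orbits_def orbit_def)

lemma Orb_eq_image:
  assumes "e \<in> Orb i"
  shows "Orb i = (\<lambda>g. g ` e) ` \<Psi>"
proof -
  have "Orb i \<in> edge_orbits E \<Psi>" using Orb by (auto simp: bij_betw_def)
  then obtain e0 where e0: "e0 \<in> E" "Orb i = (\<lambda>g. g ` e0) ` \<Psi>"
    by (auto simp: edge_orbits_eq)
  then obtain k where k: "k \<in> \<Psi>" "e = k ` e0" using assms by auto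
  have "(\<lambda>g. g ` e) ` \<Psi> = (\<lambda>g. g ` e0) ` (\<lambda>g. g \<circ> k) ` \<Psi>"
    by (simp add: k(2) image_image image_comp)
  then show ?thesis
    using e0 bij_betw_comp_right[OF k(1)] by (simp add: bij_betw_def)
qed

lemma Orb_subset: "Orb i \<subseteq> E"
proof -
  have "Orb i \<in> edge_orbits E \<Psi>" using Orb by (auto simp: bij_betw_def)
  then show ?thesis using image_edge by (auto simp: edge_orbits_eq)
qed

lemma card_Orb_edge: "e \<in> Orb i \<Longrightarrow> card e = 2"
  using Orb_subset card_edge by blast

lemma Orb_unique:
  assumes "e \<in> Orb i" "e \<in> Orb j"
  shows "i = j"
proof -
  have "Orb i = Orb j" using assms Orb_eq_image by metis
  then show ?thesis using Orb by (auto simp: bij_betw_def inj_on_def)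
qed

lemma Orb_cover:
  assumes "e \<in> E"
  shows "\<exists>i. e \<in> Orb i"
proof -
  have "e \<in> (\<lambda>g. g ` e) ` \<Psi>" using id_mem by (intro image_eqI[of _ _ id]) auto
  moreover have "(\<lambda>g. g ` e) ` \<Psi> \<in> range Orb"
    using Orb assms by (auto simp: bij_betw_def edge_orbits_eq)
  ultimately show ?thesis by auto
qed

lemma sum_edges_by_orbits: "(\<Sum>e\<in>E. f e) = (\<Sum>i\<in>UNIV. \<Sum>e\<in>Orb i. f e)"
proof -
  have "E = (\<Union>i. Orb i)" using Orb_subset Orb_cover by blast
  moreover have "Orb i \<inter> Orb j = {}" if "i \<noteq> j" for i j
    using Orb_unique that by blast
  ultimately show ?thesis
    by (simp add: sum.UNION_disjoint)
qed

lemma bij_betw_image_Orb: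
  assumes "g \<in> \<Psi>"
  shows "bij_betw (\<lambda>e. g ` e) (Orb i) (Orb i)"
proof -
  have "(\<lambda>e. g ` e) ` Orb i \<subseteq> Orb i"
  proof (rule image_subsetI)
    show "g ` e \<in> Orb i" if "e \<in> Orb i" for e
      using Orb_eq_image[OF that] assms by auto
  qed
  moreover have "inj_on (\<lambda>e. g ` e) (Orb i)"
    using bij_is_inj[OF bij[OF assms]] by (intro inj_onI) (simp add: inj_image_eq_iff)
  ultimately show ?thesis by (simp add: bij_betw_def endo_inj_surj)
qed

lemma orbit_energy_translate:
  assumes "g \<in> \<Psi>"
  shows "orbit_energy Orb (translate g x) = orbit_energy Orb x"
proof -
  have "(\<Sum>e\<in>Orb i. sq_diff (translate g x) e) = (\<Sum>e\<in>Orb i. sq_diff x e)" for i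
    using sum.reindex_bij_betw[OF bij_betw_image_Orb[OF assms], of "sq_diff x" i]
    by (simp add: sq_diff_translate card_Orb_edge)
  then show ?thesis by (simp add: orbit_energy_def)
qed

lemma orbit_energy_scaleR: "orbit_energy Orb (c *\<^sub>R x) = c\<^sup>2 *\<^sub>R orbit_energy Orb x"
  by (simp add: orbit_energy_def vec_eq_iff sum_distrib_left sq_diff_scaleR card_Orb_edge)

lemma continuous_on_orbit_energy: "continuous_on S (orbit_energy Orb)"
  unfolding orbit_energy_def
  by (intro continuous_on_vec_lambda continuous_on_sum continuous_on_sq_diff) (rule card_Orb_edge)

lemma sum_orbit_energy: "1 \<bullet> orbit_energy Orb x = x \<bullet> (L *v x)"
  by (simp add: inner_vec_def[of 1] orbit_energy_def laplacian_quadratic_form[OF simple] sum_edges_by_orbits)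

lemma sum_orbit_sizes: "1 \<bullet> orbit_sizes Orb = real (card E)"
  using sum_edges_by_orbits[of "\<lambda>_. 1::nat"] by (simp add: inner_vec_def[of 1] orbit_sizes_def flip: of_nat_sum)

lemma laplacian_translate:
  assumes "g \<in> \<Psi>"
  shows "L *v translate g x = translate g (L *v x)"
proof -
  \<comment> \<open>automorphisms preserve degrees, the diagonal entries of the Laplacian\<close>
  have card: "card {e \<in> E. g u \<in> e} = card {e \<in> E. u \<in> e}" for u
  proof (rule bij_betw_same_card[symmetric, of "\<lambda>e. g ` e"], rule bij_betw_byWitness[where f' = "\<lambda>e. inv_into UNIV g ` e"])
    note g = bij_is_inj[OF bij[OF assms]] bij_is_surj[OF bij[OF assms]]
    show "\<forall>e\<in>{e \<in> E. u \<in> e}. inv_into UNIV g ` g ` e = e" "\<forall>e\<in>{e \<in> E. g u \<in> e}. g ` inv_into UNIV g ` e = e"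
      using g by (auto simp: image_inv_f_f image_f_inv_f)
    show "(\<lambda>e. g ` e) ` {e \<in> E. u \<in> e} \<subseteq> {e \<in> E. g u \<in> e}"
      using image_edge[OF assms] by auto
    show "(\<lambda>e. inv_into UNIV g ` e) ` {e \<in> E. g u \<in> e} \<subseteq> {e \<in> E. u \<in> e}"
      using image_edge[OF inv_mem[OF assms]] g by (auto intro: image_eqI[of _ _ "g u"])
  qed
  have entry: "L $ u $ v = L $ g u $ g v" for u v
    using bij_is_inj[OF bij[OF assms]] edge_iff[OF assms, of u v] card
    by (simp add: laplacian_def inj_eq)
  have "(L *v translate g x) $ u = translate g (L *v x) $ u" for u
    using sum.reindex_bij_betw[OF bij[OF assms], of "\<lambda>v. L $ g u $ v * x $ v"]
    by (simp add: matrix_vector_mult_def entry[symmetric])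
  then show ?thesis by (simp add: vec_eq_iff)
qed

lemma translate_eigenspace:
  assumes "g \<in> \<Psi>" "x \<in> eigenspace L \<mu>"
  shows "translate g x \<in> eigenspace L \<mu>"
  using assms by (simp add: eigenspace_def laplacian_translate linear_scale[OF linear_translate])

end

section \<open>Convexity of the orbit energies of an invariant subspace\<close>

locale vertex_transitive_symmetries = graph_symmetries E \<Psi> Orb
  for E :: "'v::finite set set" and \<Psi> :: "('v \<Rightarrow> 'v) set" and Orb :: "'s::finite \<Rightarrow> 'v set set" +
  assumes transitive: "\<exists>g\<in>\<Psi>. g u = v"
begin

text \<open>A sum of two energy vectors is the energy vector of one column of the square root of the averaged
operator, since vertex-transitivity makes the energies of all columns agree.\<close>

lemma orbit_energy_add:
  assumes S: "subspace S" "\<And>g x. g \<in> \<Psi> \<Longrightarrow> x \<in> S \<Longrightarrow> translate g x \<in> S"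
    and \<phi>: "\<phi> \<in> S" and \<psi>: "\<psi> \<in> S"
  shows "\<exists>\<omega>\<in>S. orbit_energy Orb \<omega> = orbit_energy Orb \<phi> + orbit_energy Orb \<psi>"
proof -
  define X where "X x = (\<Sum>g\<in>\<Psi>. (translate g \<phi> \<bullet> x) *\<^sub>R translate g \<phi> + (translate g \<psi> \<bullet> x) *\<^sub>R translate g \<psi>)" for x
  have X_lin: "linear X"
    by (intro linearI) (simp_all add: X_def inner_add_right algebra_simps sum.distrib scaleR_sum_right)
  have X_sym: "X x \<bullet> y = x \<bullet> X y" for x y
    by (simp add: X_def inner_sum_left inner_sum_right inner_add_left inner_add_right mult_ac inner_commute)
  have X_quad: "x \<bullet> X x = (\<Sum>g\<in>\<Psi>. (translate g \<phi> \<bullet> x)\<^sup>2 + (translate g \<psi> \<bullet> x)\<^sup>2)" for x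
    by (simp add: X_def inner_sum_right inner_add_right power2_eq_square inner_commute)
  have X_pos: "x \<bullet> X x \<ge> 0" for x
    unfolding X_quad by (intro sum_nonneg) simp
  have X_range: "range X \<subseteq> S"
    using S \<phi> \<psi> by (auto simp: X_def intro!: subspace_sum subspace_add subspace_scale)
  \<comment> \<open>averaging over the group is what makes \<open>X\<close> equivariant\<close>
  have X_comm: "translate k (X x) = X (translate k x)" if k: "k \<in> \<Psi>" for k x
  proof -
    have "X (translate k x) = (\<Sum>g\<in>\<Psi>. (translate (g \<circ> k) \<phi> \<bullet> translate k x) *\<^sub>R translate (g \<circ> k) \<phi>
        + (translate (g \<circ> k) \<psi> \<bullet> translate k x) *\<^sub>R translate (g \<circ> k) \<psi>)"
      unfolding X_def by (rule sum.reindex_bij_betw[OF bij_betw_comp_right[OF k], symmetric])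
    also have "\<dots> = translate k (X x)"
      by (simp add: X_def linear_sum[OF linear_translate] linear_add[OF linear_translate]
          linear_scale[OF linear_translate] inner_translate[OF bij[OF k]] flip: translate_translate)
    finally show ?thesis by simp
  qed
  obtain h where h: "linear h" "\<forall>x y. h x \<bullet> y = x \<bullet> h y" "\<forall>x. h (h x) = X x" "range h \<subseteq> range X"
      and h_comm: "\<forall>T. linear T \<longrightarrow> (\<forall>y. T (X y) = X (T y)) \<longrightarrow> (\<forall>x. T (h x) = h (T x))"
    using positive_square_root[OF X_lin X_sym X_pos] by blast
  define c where "c v = h (axis v 1)" for v
  have const: "orbit_energy Orb (c v) = orbit_energy Orb (c w)" for v w
  proof -
    obtain k where k: "k \<in> \<Psi>" "k v = w" using transitive by blast
    have "translate k (c w) = c v"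
      using h_comm[rule_format, OF linear_translate X_comm[OF k(1)]] translate_axis[OF bij_is_inj[OF bij[OF k(1)]], of v]
      by (simp add: c_def k(2))
    then show ?thesis using orbit_energy_translate[OF k(1), of "c w"] by simp
  qed
  have col: "(\<Sum>v\<in>UNIV. sq_diff (c v) e) = (\<Sum>g\<in>\<Psi>. sq_diff (translate g \<phi>) e + sq_diff (translate g \<psi>) e)"
    if e2: "card e = 2" for e
  proof -
    obtain a b where e: "e = {a, b}" using e2 by (auto simp: card_2_iff)
    define \<delta> where "\<delta> = (axis a 1 - axis b 1 :: real^'v)"
    have entry: "c v $ u = h (axis u 1) $ v" for u v
      using h(2)[rule_format, of "axis v 1" "axis u 1"]
      by (simp add: c_def inner_axis inner_axis')
    \<comment> \<open>by symmetry of \<open>h\<close>, collecting the entries of all columns at a vertex gives the column of that vertex\<close>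
    have "(\<Sum>v\<in>UNIV. sq_diff (c v) e) = h \<delta> \<bullet> h \<delta>"
      by (simp add: e sq_diff_doubleton entry \<delta>_def linear_diff[OF h(1)] inner_vec_def power2_eq_square)
    also have "\<dots> = \<delta> \<bullet> X \<delta>" by (simp add: h(2,3))
    also have "\<dots> = (\<Sum>g\<in>\<Psi>. sq_diff (translate g \<phi>) e + sq_diff (translate g \<psi>) e)"
      by (simp add: X_quad e sq_diff_doubleton \<delta>_def inner_diff_right inner_axis)
    finally show ?thesis .
  qed
  \<comment> \<open>both sides are the total energy of all columns of \<open>h\<close>\<close>
  have total: "real CARD('v) *\<^sub>R orbit_energy Orb (c v) = real (card \<Psi>) *\<^sub>R (orbit_energy Orb \<phi> + orbit_energy Orb \<psi>)" for v
  proof -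
    have "real CARD('v) *\<^sub>R orbit_energy Orb (c v) = (\<Sum>w\<in>UNIV. orbit_energy Orb (c w))"
    proof -
      have "(\<Sum>w\<in>UNIV. orbit_energy Orb (c w)) = (\<Sum>w\<in>(UNIV :: 'v set). orbit_energy Orb (c v))"
        by (intro sum.cong const refl)
      then show ?thesis by (simp only: sum_constant_scaleR)
    qed
    also have "\<dots> = (\<Sum>g\<in>\<Psi>. orbit_energy Orb (translate g \<phi>) + orbit_energy Orb (translate g \<psi>))"
    proof -
      have "(\<Sum>w\<in>UNIV. \<Sum>e\<in>Orb i. sq_diff (c w) e)
          = (\<Sum>g\<in>\<Psi>. (\<Sum>e\<in>Orb i. sq_diff (translate g \<phi>) e) + (\<Sum>e\<in>Orb i. sq_diff (translate g \<psi>) e))" for i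
        by (subst sum.swap, simp only: sum.distrib[symmetric], subst (2) sum.swap)
          (intro sum.cong refl col card_Orb_edge)
      then show ?thesis by (simp add: vec_eq_iff orbit_energy_def)
    qed
    also have "\<dots> = real (card \<Psi>) *\<^sub>R (orbit_energy Orb \<phi> + orbit_energy Orb \<psi>)"
      by (simp add: orbit_energy_translate sum_constant_scaleR del: sum_constant)
    finally show ?thesis .
  qed
  fix v :: 'v
  have "c v \<in> S" using h(4) X_range by (auto simp: c_def)
  then have "sqrt (real CARD('v) / real (card \<Psi>)) *\<^sub>R c v \<in> S" using S by (intro subspace_scale)
  moreover have "orbit_energy Orb (sqrt (real CARD('v) / real (card \<Psi>)) *\<^sub>R c v)
      = (1 / real (card \<Psi>)) *\<^sub>R real CARD('v) *\<^sub>R orbit_energy Orb (c v)"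
    by (simp add: orbit_energy_scaleR)
  then have "orbit_energy Orb (sqrt (real CARD('v) / real (card \<Psi>)) *\<^sub>R c v)
      = orbit_energy Orb \<phi> + orbit_energy Orb \<psi>"
    unfolding total using card_group_pos by (simp add: card_gt_0_iff)
  ultimately show ?thesis by blast
qed

lemma convex_cone_orbit_energy: "convex_cone (orbit_energy Orb ` eigenspace L \<mu>)"
  unfolding convex_cone_iff
proof (intro conjI ballI allI impI)
  have "orbit_energy Orb 0 = 0" using orbit_energy_scaleR[of 0 0] by simp
  then show "0 \<in> orbit_energy Orb ` eigenspace L \<mu>"
    using subspace_0[OF subspace_eigenspace, of L \<mu>] by (metis image_eqI)
next
  fix p q assume "p \<in> orbit_energy Orb ` eigenspace L \<mu>" "q \<in> orbit_energy Orb ` eigenspace L \<mu>"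
  then show "p + q \<in> orbit_energy Orb ` eigenspace L \<mu>"
    using orbit_energy_add[OF subspace_eigenspace translate_eigenspace] by (smt (verit) imageE image_eqI)
next
  fix p and c :: real assume "p \<in> orbit_energy Orb ` eigenspace L \<mu>" "c \<ge> 0"
  then obtain x where x: "x \<in> eigenspace L \<mu>" "p = orbit_energy Orb x" by auto
  have "sqrt c *\<^sub>R x \<in> eigenspace L \<mu>" using x subspace_eigenspace by (intro subspace_scale)
  moreover have "c *\<^sub>R p = orbit_energy Orb (sqrt c *\<^sub>R x)"
    using \<open>c \<ge> 0\<close> by (simp add: orbit_energy_scaleR x)
  ultimately show "c *\<^sub>R p \<in> orbit_energy Orb ` eigenspace L \<mu>" by blast
qed

end

section \<open>An energy certificate forces rigidity\<close>

context graph_symmetries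
begin

text \<open>The left-hand side depends only on the orbit of \<open>e\<close>, and its mean over an orbit is the mean energy of
\<open>\<phi>\<close> there, counted once for each group element. The hypothesis on \<open>\<phi>\<close> says that this mean energy is
\<open>1\<close> on every orbit.\<close>

lemma sum_group_sq_diff:
  assumes \<phi>: "orbit_energy Orb \<phi> = orbit_sizes Orb" and e: "e \<in> E"
  shows "(\<Sum>g\<in>\<Psi>. sq_diff \<phi> (g ` e)) = real (card \<Psi>)"
proof -
  define F where "F e = (\<Sum>g\<in>\<Psi>. sq_diff \<phi> (g ` e))" for e
  obtain i where i: "e \<in> Orb i" using Orb_cover[OF e] by blast
  have F: "F e' = F e" if e': "e' \<in> Orb i" for e'
  proof -
    obtain k where k: "k \<in> \<Psi>" "e' = k ` e" using Orb_eq_image[OF i] e' by auto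
    have "F e = (\<Sum>g\<in>\<Psi>. sq_diff \<phi> ((g \<circ> k) ` e))"
      unfolding F_def by (rule sum.reindex_bij_betw[OF bij_betw_comp_right[OF k(1)], symmetric])
    then show ?thesis by (simp add: F_def k(2) image_comp)
  qed
  have "real (card (Orb i)) * F e = (\<Sum>e'\<in>Orb i. F e')"
    using F by simp
  also have "\<dots> = (\<Sum>g\<in>\<Psi>. \<Sum>e'\<in>Orb i. sq_diff \<phi> (g ` e'))"
    unfolding F_def by (rule sum.swap)
  also have "\<dots> = (\<Sum>g\<in>\<Psi>. \<Sum>e'\<in>Orb i. sq_diff \<phi> e')"
    by (intro sum.cong refl sum.reindex_bij_betw bij_betw_image_Orb)
  also have "(\<Sum>e'\<in>Orb i. sq_diff \<phi> e') = real (card (Orb i))"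
    using \<phi> by (simp add: orbit_energy_def orbit_sizes_def vec_eq_iff)
  finally have "real (card (Orb i)) * F e = real (card (Orb i)) * real (card \<Psi>)" by simp
  moreover have "Orb i \<noteq> {}" using i by blast
  ultimately show ?thesis by (simp add: F_def)
qed

text \<open>On average over the group, a certificate cannot distinguish an admissible weight from the constant one.\<close>

lemma sum_group_quadratic_form:
  assumes \<phi>: "orbit_energy Orb \<phi> = orbit_sizes Orb" and w: "admissible_weight E w"
  shows "(\<Sum>g\<in>\<Psi>. translate g \<phi> \<bullet> (laplacian E w *v translate g \<phi>)) = real (card \<Psi>) * (\<phi> \<bullet> (L *v \<phi>))"
proof -
  have "(\<Sum>g\<in>\<Psi>. translate g \<phi> \<bullet> (laplacian E w *v translate g \<phi>))
      = (\<Sum>e\<in>E. w e * (\<Sum>g\<in>\<Psi>. sq_diff \<phi> (g ` e)))"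
    unfolding laplacian_quadratic_form[OF simple] sum_distrib_left
    by (subst sum.swap) (simp add: sq_diff_translate card_edge)
  also have "\<dots> = real (card \<Psi>) * (\<Sum>e\<in>E. w e)"
    using sum_group_sq_diff[OF \<phi>] by (simp add: sum_distrib_right mult.commute)
  also have "(\<Sum>e\<in>E. w e) = \<phi> \<bullet> (L *v \<phi>)"
    using w \<phi> sum_orbit_energy[of \<phi>] sum_orbit_sizes by (simp add: admissible_weight_def)
  finally show ?thesis .
qed

text \<open>Since the graph is connected, \<open>\<lambda>\<^sub>2\<close> is positive, so \<open>\<phi>\<close> and its translates are orthogonal to the constants
and serve as test vectors for \<open>\<lambda>\<^sub>2(w)\<close>. Summed over the group, the Rayleigh bounds have a right-hand
side independent of \<open>w\<close>.\<close>

lemma lower_rigid_if_certificate: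
  assumes n: "CARD('v) \<ge> 2" and conn: "connected_graph E"
    and \<phi>: "\<phi> \<in> eigenspace L (lap_eig E (\<lambda>_. 1) 2)" "orbit_energy Orb \<phi> = orbit_sizes Orb"
    and E: "E \<noteq> {}"
  shows "lower_conformally_rigid E"
  unfolding lower_conformally_rigid_def
proof (intro allI impI)
  fix w assume w: "admissible_weight E w"
  let ?m = "lap_eig E (\<lambda>_. 1) 2"
  have L\<phi>: "L *v \<phi> = ?m *\<^sub>R \<phi>" using \<phi>(1) by (simp add: eigenspace_def)
  have m: "?m > 0" using simple conn n by (rule lap_eig_2_pos)
  have "?m * (1 \<bullet> \<phi>) = 1 \<bullet> (L *v \<phi>)" by (simp add: L\<phi>)
  also have "\<dots> = 0"
    using symmetric_matrix_inner[OF transpose_laplacian, of E "\<lambda>_. 1" 1 \<phi>] laplacian_ones[OF simple, of "\<lambda>_. 1"]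
    by simp
  finally have orth: "1 \<bullet> \<phi> = 0" using m by simp
  have "1 \<bullet> translate g \<phi> = 0" if "g \<in> \<Psi>" for g
    using inner_translate[OF bij[OF that], of 1 \<phi>] orth by (simp add: translate_def one_vec_def)
  then have "(\<Sum>g\<in>\<Psi>. lap_eig E w 2 * (translate g \<phi> \<bullet> translate g \<phi>))
      \<le> (\<Sum>g\<in>\<Psi>. translate g \<phi> \<bullet> (laplacian E w *v translate g \<phi>))"
    using w n by (intro sum_mono lap_eig_2(2)[OF simple]) (auto simp: admissible_weight_def)
  then have "real (card \<Psi>) * (lap_eig E w 2 * (\<phi> \<bullet> \<phi>)) \<le> real (card \<Psi>) * (?m * (\<phi> \<bullet> \<phi>))"
    by (simp add: sum_group_quadratic_form[OF \<phi>(2) w] L\<phi> inner_translate bij)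
  moreover have "\<phi> \<bullet> \<phi> > 0"
  proof -
    have "?m * (\<phi> \<bullet> \<phi>) = real (card E)"
      using sum_orbit_energy[of \<phi>] \<phi>(2) sum_orbit_sizes by (simp add: L\<phi>)
    then show ?thesis using E by (auto simp: card_eq_0_iff)
  qed
  ultimately show "lap_eig E w 2 \<le> ?m" using card_group_pos by simp
qed

lemma upper_rigid_if_certificate:
  assumes \<phi>: "\<phi> \<in> eigenspace L (lap_eig E (\<lambda>_. 1) CARD('v))" "orbit_energy Orb \<phi> = orbit_sizes Orb"
    and E: "E \<noteq> {}"
  shows "upper_conformally_rigid E"
  unfolding upper_conformally_rigid_def
proof (intro allI impI)
  fix w assume w: "admissible_weight E w"
  let ?m = "lap_eig E (\<lambda>_. 1) CARD('v)"
  have L\<phi>: "L *v \<phi> = ?m *\<^sub>R \<phi>" using \<phi>(1) by (simp add: eigenspace_def)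
  have "(\<Sum>g\<in>\<Psi>. translate g \<phi> \<bullet> (laplacian E w *v translate g \<phi>))
      \<le> (\<Sum>g\<in>\<Psi>. lap_eig E w CARD('v) * (translate g \<phi> \<bullet> translate g \<phi>))"
    by (intro sum_mono lap_eig_max(2))
  then have "real (card \<Psi>) * (?m * (\<phi> \<bullet> \<phi>)) \<le> real (card \<Psi>) * (lap_eig E w CARD('v) * (\<phi> \<bullet> \<phi>))"
    by (simp add: sum_group_quadratic_form[OF \<phi>(2) w] L\<phi> inner_translate bij)
  moreover have "\<phi> \<bullet> \<phi> > 0"
  proof -
    have "?m * (\<phi> \<bullet> \<phi>) = real (card E)"
      using sum_orbit_energy[of \<phi>] \<phi>(2) sum_orbit_sizes by (simp add: L\<phi>)
    then show ?thesis using E by (auto simp: card_eq_0_iff)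
  qed
  ultimately show "?m \<le> lap_eig E w CARD('v)" using card_group_pos by simp
qed

end

section \<open>Rigidity yields an energy certificate\<close>

text \<open>Where \<open>q\<close> is positive the perturbation only helps. The remaining points form a compact set on which
\<open>p\<close> keeps a positive distance from \<open>m\<close>, and a small multiple of the bounded function \<open>q\<close> cannot bridge it.
This replaces the derivative of an eigenvalue, possibly multiple, with respect to the weights.\<close>

lemma compact_perturbation_bound:
  fixes p q :: "'a::metric_space \<Rightarrow> real"
  assumes K: "compact K" and p: "continuous_on K p" and q: "continuous_on K q"
    and ge: "\<And>x. x \<in> K \<Longrightarrow> m \<le> p x"
    and gt: "\<And>x. x \<in> K \<Longrightarrow> p x = m \<Longrightarrow> q x > 0"
  shows "\<exists>\<delta>>0. \<forall>\<epsilon>. 0 < \<epsilon> \<longrightarrow> \<epsilon> \<le> \<delta> \<longrightarrow> (\<forall>x\<in>K. p x + \<epsilon> * q x > m)"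
proof -
  define F where "F = {x\<in>K. q x \<le> 0}"
  have F: "compact F"
    unfolding F_def using continuous_closedin_preimage[OF q closed_atMost[of 0]] K
    by (auto intro!: closedin_compact[of K] simp: vimage_def Int_def)
  show ?thesis
  proof (cases "F = {}")
    case True
    have "p x + \<epsilon> * q x > m" if "x \<in> K" "0 < \<epsilon>" for x \<epsilon>
    proof -
      have "q x > 0" using True that(1) by (auto simp: F_def not_le)
      then have "\<epsilon> * q x > 0" using that(2) by simp
      then show ?thesis using ge[OF that(1)] by linarith
    qed
    then show ?thesis by (intro exI[of _ 1]) auto
  next
    case False
    obtain x0 where x0: "x0 \<in> F" "\<And>x. x \<in> F \<Longrightarrow> p x0 \<le> p x"
      using continuous_attains_inf[OF F False continuous_on_subset[OF p]] by (auto simp: F_def)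
    have gap: "p x0 > m"
      using x0(1) ge[of x0] gt[of x0] by (force simp: F_def)
    obtain M where M: "M > 0" "\<And>x. x \<in> K \<Longrightarrow> \<bar>q x\<bar> \<le> M"
      using compact_imp_bounded[OF compact_continuous_image[OF q K]] by (auto simp: bounded_pos)
    show ?thesis
    proof (intro exI[of _ "(p x0 - m) / (2 * M)"] conjI allI impI ballI)
      show "0 < (p x0 - m) / (2 * M)" using gap M by simp
      fix \<epsilon> x assume \<epsilon>: "0 < \<epsilon>" "\<epsilon> \<le> (p x0 - m) / (2 * M)" and x: "x \<in> K"
      show "m < p x + \<epsilon> * q x"
      proof (cases "q x > 0")
        case True
        then have "\<epsilon> * q x > 0" using \<epsilon> by simp
        then show ?thesis using ge[OF x] by linarith
      next
        case False
        then have "p x0 \<le> p x" using x x0 by (auto simp: F_def)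
        have "\<epsilon> * \<bar>q x\<bar> \<le> (p x0 - m) / (2 * M) * M"
          using \<epsilon> M(2)[OF x] M(1) by (intro mult_mono) auto
        also have "\<dots> = (p x0 - m) / 2" using M(1) by simp
        also have "\<dots> < p x0 - m" using gap by simp
        finally show ?thesis
          using \<open>p x0 \<le> p x\<close> False by (simp add: abs_if split: if_splits)
      qed
    qed
  qed
qed

lemma small_multiple:
  fixes a :: "'a::real_normed_vector"
  assumes "\<delta> > 0"
  obtains \<epsilon> :: real where "0 < \<epsilon>" "\<epsilon> \<le> \<delta>" "norm (\<epsilon> *\<^sub>R a) \<le> 1"
proof
  show "0 < min \<delta> (1 / (1 + norm a))" using assms by (simp add: add_pos_nonneg)
  have "min \<delta> (1 / (1 + norm a)) * norm a \<le> 1 / (1 + norm a) * norm a"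
    by (intro mult_right_mono) auto
  also have "\<dots> \<le> 1" by (simp add: divide_le_eq add_pos_nonneg)
  finally show "norm (min \<delta> (1 / (1 + norm a)) *\<^sub>R a) \<le> 1"
    using assms by simp
qed simp

context graph_symmetries
begin

text \<open>On a set that is not an edge this index is arbitrary.\<close>

definition orbit_index :: "'v set \<Rightarrow> 's" where
  "orbit_index e = (THE i. e \<in> Orb i)"

lemma orbit_index_eq: "e \<in> Orb i \<Longrightarrow> orbit_index e = i"
  unfolding orbit_index_def using Orb_unique by (intro the_equality) auto

definition orbit_weight :: "real^'s \<Rightarrow> 'v set \<Rightarrow> real" where
  "orbit_weight a e = 1 + a $ orbit_index e"

lemma laplacian_orbit_weight:
  "x \<bullet> (laplacian E (orbit_weight a) *v x) = x \<bullet> (L *v x) + a \<bullet> orbit_energy Orb x"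
proof -
  have "(\<Sum>e\<in>Orb i. orbit_weight a e * sq_diff x e) = (\<Sum>e\<in>Orb i. sq_diff x e) + a $ i * (\<Sum>e\<in>Orb i. sq_diff x e)" for i
    by (simp add: orbit_weight_def orbit_index_eq algebra_simps sum.distrib sum_distrib_left)
  then show ?thesis
    by (simp add: laplacian_quadratic_form[OF simple] sum_edges_by_orbits sum.distrib
        inner_vec_def[of a] orbit_energy_def)
qed

text \<open>Orthogonality to the orbit sizes preserves the total weight, and the bound on the norm keeps all weights
nonnegative.\<close>

lemma admissible_orbit_weight:
  assumes "a \<bullet> orbit_sizes Orb = 0" "norm a \<le> 1"
  shows "admissible_weight E (orbit_weight a)"
proof -
  have "(\<Sum>e\<in>Orb i. orbit_weight a e) = real (card (Orb i)) + a $ i * real (card (Orb i))" for i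
    by (simp add: orbit_weight_def orbit_index_eq algebra_simps)
  then have "(\<Sum>e\<in>E. orbit_weight a e) = 1 \<bullet> orbit_sizes Orb + a \<bullet> orbit_sizes Orb"
    by (simp add: sum_edges_by_orbits sum.distrib inner_vec_def orbit_sizes_def)
  moreover have "orbit_weight a e \<ge> 0" for e
    using component_le_norm_cart[of a "orbit_index e"] assms(2) by (simp add: orbit_weight_def)
  ultimately show ?thesis using assms(1) by (simp add: admissible_weight_def sum_orbit_sizes)
qed

end

context vertex_transitive_symmetries
begin

text \<open>The energies of an eigenvector sum to \<open>\<mu>\<close> times its squared norm, so fixing the norm cuts out of the
cone of energies the slice by the hyperplane through the vector of orbit sizes on which the entries
sum to the number of edges. The slice is compact and convex. Adding a multiple of the all-ones vector
to a separating functional changes it by a constant on that hyperplane, which lets it vanish at the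
vector of orbit sizes; by homogeneity it is then positive on all nonzero eigenvectors.\<close>

lemma separating_direction:
  assumes \<mu>: "\<mu> > 0" and E: "E \<noteq> {}"
    and no: "orbit_sizes Orb \<notin> orbit_energy Orb ` eigenspace L \<mu>"
  shows "\<exists>a. a \<bullet> orbit_sizes Orb = 0 \<and> (\<forall>x\<in>eigenspace L \<mu>. x \<noteq> 0 \<longrightarrow> a \<bullet> orbit_energy Orb x > 0)"
proof -
  have cE: "real (card E) > 0" using E by (simp add: card_gt_0_iff)
  \<comment> \<open>the norm of an eigenvector whose total energy is the number of edges\<close>
  define r where "r = sqrt (real (card E) / \<mu>)"
  have r: "r > 0" "\<mu> * r\<^sup>2 = real (card E)" using cE \<mu> by (simp_all add: r_def)
  define K where "K = orbit_energy Orb ` (eigenspace L \<mu> \<inter> sphere 0 r)"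
  have tot: "1 \<bullet> orbit_energy Orb x = \<mu> * (norm x)\<^sup>2" if "x \<in> eigenspace L \<mu>" for x
    using that by (simp add: sum_orbit_energy eigenspace_def dot_square_norm)
  have norm_iff: "norm x = r \<longleftrightarrow> 1 \<bullet> orbit_energy Orb x = real (card E)" if "x \<in> eigenspace L \<mu>" for x
    unfolding tot[OF that] r(2)[symmetric] using r(1) \<mu> by simp
  have K_eq: "K = orbit_energy Orb ` eigenspace L \<mu> \<inter> {c. 1 \<bullet> c = real (card E)}"
    using norm_iff by (auto simp: K_def)
  have "convex K"
    unfolding K_eq using convex_cone_orbit_energy by (intro convex_Int convex_hyperplane) (simp add: convex_cone_def)
  moreover have "closed K"
    unfolding K_def
    by (intro compact_imp_closed compact_continuous_image continuous_on_orbit_energy closed_Int_compact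
        closed_subspace subspace_eigenspace compact_sphere)
  moreover have "orbit_sizes Orb \<notin> K" using no by (auto simp: K_eq)
  ultimately obtain a b where ab: "a \<bullet> orbit_sizes Orb < b" "\<forall>c\<in>K. a \<bullet> c > b"
    using separating_hyperplane_closed_point[of K "orbit_sizes Orb"] by auto
  define a' where "a' = a - ((a \<bullet> orbit_sizes Orb) / real (card E)) *\<^sub>R 1"
  have "a' \<bullet> orbit_sizes Orb = 0"
    using E by (simp add: a'_def inner_diff_left sum_orbit_sizes)
  moreover have "a' \<bullet> orbit_energy Orb x > 0" if x: "x \<in> eigenspace L \<mu>" "x \<noteq> 0" for x
  proof -
    define c where "c = r / norm x"
    have "c > 0" using r x by (simp add: c_def)
    have "c *\<^sub>R x \<in> eigenspace L \<mu> \<inter> sphere 0 r"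
      using x r subspace_eigenspace by (auto simp: c_def intro!: subspace_scale)
    then have y: "orbit_energy Orb (c *\<^sub>R x) \<in> K" by (auto simp: K_def)
    then have "1 \<bullet> orbit_energy Orb (c *\<^sub>R x) = real (card E)" by (auto simp: K_eq)
    then have "a' \<bullet> orbit_energy Orb (c *\<^sub>R x) = a \<bullet> orbit_energy Orb (c *\<^sub>R x) - a \<bullet> orbit_sizes Orb"
      using E by (simp add: a'_def inner_diff_left)
    also have "\<dots> > 0" using ab(1) bspec[OF ab(2) y] by simp
    finally have "c\<^sup>2 * (a' \<bullet> orbit_energy Orb x) > 0" by (simp add: orbit_energy_scaleR)
    then show ?thesis by (rule zero_less_mult_pos) (use \<open>c > 0\<close> in simp)
  qed
  ultimately show ?thesis by blast
qed

text \<open>If there is no certificate, perturbing the weights along the separating direction raises the Rayleigh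
quotient above \<open>\<lambda>\<^sub>2\<close> everywhere on the unit sphere of the orthogonal complement of the constants: near
the eigenspace to first order, and elsewhere because it was already larger.\<close>

lemma certificate_if_lower_rigid:
  assumes n: "CARD('v) \<ge> 2" and conn: "connected_graph E" and E: "E \<noteq> {}"
    and rigid: "lower_conformally_rigid E"
  shows "orbit_sizes Orb \<in> orbit_energy Orb ` eigenspace L (lap_eig E (\<lambda>_. 1) 2)"
proof (rule ccontr)
  let ?m = "lap_eig E (\<lambda>_. 1) 2"
  assume "\<not> ?thesis"
  then obtain a where a: "a \<bullet> orbit_sizes Orb = 0"
      "\<And>x. x \<in> eigenspace L ?m \<Longrightarrow> x \<noteq> 0 \<Longrightarrow> a \<bullet> orbit_energy Orb x > 0"
    using separating_direction[OF lap_eig_2_pos[OF simple conn n] E] by blast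
  let ?H = "{x :: real^'v. 1 \<bullet> x = 0}"
  have H: "subspace ?H" by (rule subspace_hyperplane)
  have ray: "?m * (x \<bullet> x) \<le> x \<bullet> (L *v x)" if "x \<in> ?H" for x
    using lap_eig_2(2)[OF simple _ n, of "\<lambda>_. 1" x] that by simp
  have "\<exists>\<delta>>0. \<forall>\<epsilon>. 0 < \<epsilon> \<longrightarrow> \<epsilon> \<le> \<delta> \<longrightarrow>
      (\<forall>x\<in>?H \<inter> sphere 0 1. x \<bullet> (L *v x) + \<epsilon> * (a \<bullet> orbit_energy Orb x) > ?m)"
  proof (rule compact_perturbation_bound)
    show "compact (?H \<inter> sphere 0 1)"
      by (intro closed_Int_compact closed_hyperplane compact_sphere)
    show "continuous_on (?H \<inter> sphere 0 1) (\<lambda>x. x \<bullet> (L *v x))"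
      by (intro continuous_intros)
    show "continuous_on (?H \<inter> sphere 0 1) (\<lambda>x. a \<bullet> orbit_energy Orb x)"
      by (intro continuous_intros continuous_on_orbit_energy)
    fix x assume x: "x \<in> ?H \<inter> sphere 0 1"
    then have xx: "x \<bullet> x = 1" by (simp add: dot_square_norm)
    show "?m \<le> x \<bullet> (L *v x)" using ray[of x] x xx by simp
    assume eq: "x \<bullet> (L *v x) = ?m"
    have "- (L *v x) = (- ?m) *\<^sub>R x"
    proof (rule attained_bound_imp_eigenvector[of "\<lambda>x. - (L *v x)", OF _ _ H])
      show "linear (\<lambda>x. - (L *v x))"
        by (intro linear_compose_neg matrix_vector_mul_linear)
      show "- (L *v x) \<bullet> y = x \<bullet> - (L *v y)" for x y
        by (simp add: symmetric_matrix_inner transpose_laplacian)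
      show "(\<lambda>x. - (L *v x)) ` ?H \<subseteq> ?H"
        using laplacian_ones[OF simple, of "\<lambda>_. 1"]
        by (auto simp: symmetric_matrix_inner[OF transpose_laplacian, symmetric])
      show "y \<bullet> - (L *v y) \<le> - ?m * (y \<bullet> y)" if "y \<in> ?H" for y
        using ray[OF that] by simp
    qed (use x eq xx in auto)
    then show "a \<bullet> orbit_energy Orb x > 0"
      using x by (intro a(2)) (auto simp: eigenspace_def)
  qed
  then obtain \<delta> where \<delta>: "\<delta> > 0" "\<And>\<epsilon> x. 0 < \<epsilon> \<Longrightarrow> \<epsilon> \<le> \<delta> \<Longrightarrow> x \<in> ?H \<inter> sphere 0 1
      \<Longrightarrow> x \<bullet> (L *v x) + \<epsilon> * (a \<bullet> orbit_energy Orb x) > ?m"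
    by blast
  obtain \<epsilon> where \<epsilon>: "0 < \<epsilon>" "\<epsilon> \<le> \<delta>" "norm (\<epsilon> *\<^sub>R a) \<le> 1"
    using small_multiple[OF \<delta>(1)] .
  let ?w = "orbit_weight (\<epsilon> *\<^sub>R a)"
  have w: "admissible_weight E ?w"
    using \<epsilon>(3) a(1) by (intro admissible_orbit_weight) auto
  obtain x where "x \<noteq> 0" "1 \<bullet> x = 0" "laplacian E ?w *v x = lap_eig E ?w 2 *\<^sub>R x"
    using lap_eig_2(1)[OF simple _ n, of ?w] w by (auto simp: admissible_weight_def)
  then obtain y where y: "y \<in> ?H" "norm y = 1" "y \<bullet> (laplacian E ?w *v y) = lap_eig E ?w 2"
    using exists_unit_eigenvector[OF H, of x "laplacian E ?w"] by blast
  then have "lap_eig E ?w 2 > ?m"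
    using \<delta>(2)[OF \<epsilon>(1,2), of y] by (simp add: laplacian_orbit_weight)
  then show False using rigid w by (force simp: lower_conformally_rigid_def)
qed

text \<open>The argument is the mirror image of that for \<open>\<lambda>\<^sub>2\<close>: the quadratic forms change sign, the weights move
against the separating direction, and the sphere is that of the whole space.\<close>

lemma certificate_if_upper_rigid:
  assumes n: "CARD('v) \<ge> 2" and conn: "connected_graph E" and E: "E \<noteq> {}"
    and rigid: "upper_conformally_rigid E"
  shows "orbit_sizes Orb \<in> orbit_energy Orb ` eigenspace L (lap_eig E (\<lambda>_. 1) CARD('v))"
proof (rule ccontr)
  let ?m = "lap_eig E (\<lambda>_. 1) CARD('v)"
  assume "\<not> ?thesis"
  then obtain a where a: "a \<bullet> orbit_sizes Orb = 0"
      "\<And>x. x \<in> eigenspace L ?m \<Longrightarrow> x \<noteq> 0 \<Longrightarrow> a \<bullet> orbit_energy Orb x > 0"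
    using separating_direction[OF lap_eig_max_pos[OF simple conn n] E] by blast
  have ray: "x \<bullet> (L *v x) \<le> ?m * (x \<bullet> x)" for x
    by (rule lap_eig_max(2))
  have "\<exists>\<delta>>0. \<forall>\<epsilon>. 0 < \<epsilon> \<longrightarrow> \<epsilon> \<le> \<delta> \<longrightarrow>
      (\<forall>x\<in>sphere 0 1. - (x \<bullet> (L *v x)) + \<epsilon> * (a \<bullet> orbit_energy Orb x) > - ?m)"
  proof (rule compact_perturbation_bound)
    show "continuous_on (sphere 0 1) (\<lambda>x. - (x \<bullet> (L *v x)))"
      by (intro continuous_intros)
    show "continuous_on (sphere 0 1) (\<lambda>x. a \<bullet> orbit_energy Orb x)"
      by (intro continuous_intros continuous_on_orbit_energy)
    fix x :: "real^'v" assume x: "x \<in> sphere 0 1"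
    then have xx: "x \<bullet> x = 1" by (simp add: dot_square_norm)
    show "- ?m \<le> - (x \<bullet> (L *v x))" using ray[of x] xx by simp
    assume eq: "- (x \<bullet> (L *v x)) = - ?m"
    have "L *v x = ?m *\<^sub>R x"
      by (rule attained_bound_imp_eigenvector[of "(*v) L" UNIV])
        (use eq xx ray in \<open>auto simp: symmetric_matrix_inner transpose_laplacian\<close>)
    then show "a \<bullet> orbit_energy Orb x > 0"
      using x by (intro a(2)) (auto simp: eigenspace_def)
  qed simp
  then obtain \<delta> where \<delta>: "\<delta> > 0" "\<And>\<epsilon> x. 0 < \<epsilon> \<Longrightarrow> \<epsilon> \<le> \<delta> \<Longrightarrow> x \<in> sphere 0 1
      \<Longrightarrow> - (x \<bullet> (L *v x)) + \<epsilon> * (a \<bullet> orbit_energy Orb x) > - ?m"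
    by blast
  obtain \<epsilon> where \<epsilon>: "0 < \<epsilon>" "\<epsilon> \<le> \<delta>" "norm (\<epsilon> *\<^sub>R - a) \<le> 1"
    using small_multiple[OF \<delta>(1)] .
  let ?w = "orbit_weight (\<epsilon> *\<^sub>R - a)"
  have w: "admissible_weight E ?w"
    using \<epsilon>(3) a(1) by (intro admissible_orbit_weight) auto
  obtain x where "x \<noteq> 0" "laplacian E ?w *v x = lap_eig E ?w CARD('v) *\<^sub>R x"
    using lap_eig_max(1)[of E ?w] by auto
  then obtain y where y: "norm y = 1" "y \<bullet> (laplacian E ?w *v y) = lap_eig E ?w CARD('v)"
    using exists_unit_eigenvector[OF subspace_UNIV, of x "laplacian E ?w"] by blast
  then have "lap_eig E ?w CARD('v) < ?m"
    using \<delta>(2)[OF \<epsilon>(1,2), of y] by (simp add: laplacian_orbit_weight)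
  then show False using rigid w by (force simp: upper_conformally_rigid_def)
qed

end

section \<open>Vertex-transitive groups of automorphisms\<close>

lemma mult_graph_aut_group:
  assumes "bij g" "bij h"
  shows "g \<otimes>\<^bsub>graph_aut_group E\<^esub> h = g \<circ> h"
  using assms
  by (simp add: graph_aut_group_def BijGroup_def Bij_def compose_def fun_eq_iff)

text \<open>Translation of the group-theoretic hypotheses. On the full type, the elements of the group of bijections
are plain functions, and its product is composition.\<close>

lemma vertex_transitive_symmetries_subgroup:
  fixes E :: "'v::finite set set" and Orb :: "'s::finite \<Rightarrow> 'v set set"
  assumes simple: "simple_graph E"
    and sub: "subgroup \<Psi> (graph_aut_group E)"
    and trans: "transitive_action ((graph_aut_group E)\<lparr>carrier := \<Psi>\<rparr>) UNIV (\<lambda>g. g)"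
    and orb: "bij_betw Orb UNIV (edge_orbits E \<Psi>)"
  shows "vertex_transitive_symmetries E \<Psi> Orb"
proof -
  interpret T: transitive_action "(graph_aut_group E)\<lparr>carrier := \<Psi>\<rparr>" UNIV "\<lambda>g. g"
    by (rule trans)
  interpret G: group "(graph_aut_group E)\<lparr>carrier := \<Psi>\<rparr>"
    using T.group_hom by (simp add: group_hom_def)
  have mem: "bij g" "{g u, g v} \<in> E \<longleftrightarrow> {u, v} \<in> E" if "g \<in> \<Psi>" for g u v
    using subgroup.subset[OF sub] that by (auto simp: graph_aut_group_def)
  have id: "id \<in> \<Psi>"
    using subgroup.one_closed[OF sub] by (simp add: graph_aut_group_def BijGroup_def id_def restrict_UNIV)
  have comp: "g \<circ> h \<in> \<Psi>" if "g \<in> \<Psi>" "h \<in> \<Psi>" for g h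
    using subgroup.m_closed[OF sub that] mult_graph_aut_group[of g h E] mem that by simp
  have inv: "inv_into UNIV g \<in> \<Psi>" if g: "g \<in> \<Psi>" for g
  proof -
    obtain k where k: "k \<in> \<Psi>" "k \<otimes>\<^bsub>graph_aut_group E\<^esub> g = \<one>\<^bsub>graph_aut_group E\<^esub>"
      using G.l_inv_ex[of g] g by auto
    then have "k \<circ> g = id"
      using mult_graph_aut_group[of k g E] mem(1) g by (simp add: graph_aut_group_def BijGroup_def id_def restrict_UNIV)
    then have "inv_into UNIV g = k"
      using mem(1)[OF g] by (metis bij_is_surj inv_unique_comp surj_iff left_right_inverse_eq)
    then show ?thesis using k(1) by simp
  qed
  show ?thesis
    using simple mem id comp inv orb T.unique_orbit by unfold_locales auto
qed

theorem theorem6p9: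
  fixes E :: "'v::finite set set"
    and \<Psi> :: "('v \<Rightarrow> 'v) set"
    and Orb :: "'s::finite \<Rightarrow> 'v set set"
  assumes "CARD('v) \<ge> 2"
    and "simple_graph E"
    and "connected_graph E"
    and "subgroup \<Psi> (graph_aut_group E)"
    and "transitive_action ((graph_aut_group E)\<lparr>carrier := \<Psi>\<rparr>) UNIV (\<lambda>g. g)"
    and "bij_betw Orb UNIV (edge_orbits E \<Psi>)"
  shows "(\<forall>\<mu>>0. eigenvalue (laplacian E (\<lambda>_. 1)) \<mu> \<longrightarrow>
            convex_cone (orbit_energy Orb ` eigenspace (laplacian E (\<lambda>_. 1)) \<mu>))
       \<and> (lower_conformally_rigid E \<longleftrightarrow>
            (\<exists>\<phi> \<in> eigenspace (laplacian E (\<lambda>_. 1)) (lap_eig E (\<lambda>_. 1) 2).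
               orbit_energy Orb \<phi> = orbit_sizes Orb))
       \<and> (upper_conformally_rigid E \<longleftrightarrow>
            (\<exists>\<phi> \<in> eigenspace (laplacian E (\<lambda>_. 1)) (lap_eig E (\<lambda>_. 1) CARD('v)).
               orbit_energy Orb \<phi> = orbit_sizes Orb))"
proof -
  interpret vertex_transitive_symmetries E \<Psi> Orb
    using assms(2,4-6) by (rule vertex_transitive_symmetries_subgroup)
  have E: "E \<noteq> {}" using assms(3,1) by (rule connected_graph_nonempty)
  have lower: "lower_conformally_rigid E \<longleftrightarrow>
      (\<exists>\<phi> \<in> eigenspace L (lap_eig E (\<lambda>_. 1) 2). orbit_energy Orb \<phi> = orbit_sizes Orb)"
  proof
    show "\<exists>\<phi> \<in> eigenspace L (lap_eig E (\<lambda>_. 1) 2). orbit_energy Orb \<phi> = orbit_sizes Orb"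
      if "lower_conformally_rigid E"
      using certificate_if_lower_rigid[OF assms(1,3) E that] by (auto simp: image_iff)
  qed (use lower_rigid_if_certificate[OF assms(1,3) _ _ E] in blast)
  have upper: "upper_conformally_rigid E \<longleftrightarrow>
      (\<exists>\<phi> \<in> eigenspace L (lap_eig E (\<lambda>_. 1) CARD('v)). orbit_energy Orb \<phi> = orbit_sizes Orb)"
  proof
    show "\<exists>\<phi> \<in> eigenspace L (lap_eig E (\<lambda>_. 1) CARD('v)). orbit_energy Orb \<phi> = orbit_sizes Orb"
      if "upper_conformally_rigid E"
      using certificate_if_upper_rigid[OF assms(1,3) E that] by (auto simp: image_iff)
  qed (use upper_rigid_if_certificate[OF _ _ E] in blast)
  show ?thesis using convex_cone_orbit_energy lower upper by blast
qed

end
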